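(* Let $G=(S,E)$ be a finite connected undirected graph with $n=|S|$ states, with real numbers $V_i$ ($i\in S$) and $V_{ij}=V_{ji}$ ($(i,j)\in E$) satisfying the genericness assumption: all the values $V_i$, $i\in S$, and $V_{ij}$, $(i,j)\in E$, are distinct, and all the differences $V_{ij}-V_k$, $(i,j)\in E$, $k\in S$, are distinct. Let $\mathcal{T}^{\ast}$ be the (unique) minimum spanning tree of $G$ with respect to the edge costs $c_{ij}=V_{ij}$. For $k=1,\ldots,n$ let $g_k^{\ast}$ be the optimal $W$-graph with $k$ sinks, $W_k^{\ast}$ its set of sinks, and $\mathcal{T}_k^{\ast}$ its underlying undirected forest. Then the optimal $W$-graphs are nested: $$W_k^{\ast}\subset W_{k+1}^{\ast},\qquad \mathcal{T}_k^{\ast}\supset\mathcal{T}_{k+1}^{\ast},\qquad k=1,2,\ldots,n-1$$ (the second inclusion is between edge sets), and the numbers $V^{(k)}$ satisfy $$V^{(1)}=\sum_{(i,j)\in\mathcal{T}^{\ast}}V_{ij}+\min_{i\in S}V_i-\sum_{i\in S}V_i$$ and, for $k=1,2,\ldots,n-1$, $$V^{(k+1)}=V^{(k)}-\max_{t\in\mathcal{T}_k^{\ast}}\ \max_{(p,q)\in t,\ i\in t''}\,(V_{pq}-V_i),$$ where the outer maximum is over the trees (connected components) $t$ of the forest $\mathcal{T}_k^{\ast}$ (having at least one edge), the inner maximum is over the edges $(p,q)$ of $t$ and the states $i$ of $t''$, and, for each edge $(p,q)$ of $t$, $t'$ and $t''$ are the two subtrees into which $t$ splits upon removal of $(p,q)$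 (so $t=t'\cup t''\cup\{(p,q)\}$), labelled so that $t''\cap W_k^{\ast}=\emptyset$ (i.e. $t'$ contains the sink of $t$).
   Context: $W$-graphs: let $W\subseteq S$; the states in $W$ are called sinks. A $W$-graph is a directed graph on the set of states $S$, each of whose arrows $i\to j$ goes along an edge $(i,j)\in E$, such that (i) each state in $S\setminus W$ is the origin of exactly one arrow, and states in $W$ are the origin of no arrow; (ii) there are no cycles (equivalently to (ii), from every state in $S\setminus W$ there is a sequence of arrows leading to some sink in $W$). Forgetting arrow directions turns a $W$-graph with $|W|=k$ into a forest on $S$ with exactly $k$ trees (connected components), each containing exactly one sink. $G(k)$ denotes the set of all $W$-graphs over all subsets $W$ with exactly $k$ elements. Define $$V^{(k)}=\min_{g\in G(k)}\sum_{(i\to j)\in g}(V_{ij}-V_i).$$ An element $g_k^{\ast}\in G(k)$ attaining this minimum is called an optimal $W$-graph with $k$ sinks; its set of sinks is denoted $W_k^{\ast}$ and its undirected forest is denoted $\mathcal{T}_k^{\ast}$. A minimum spanning tree is a spanning tree with minimal total sum of edge costs; under the genericness assumption it is unique. *)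

theory Defs
  imports Complex_Main
begin

text \<open>
  An undirected graph is a vertex set \<open>S\<close> with a set \<open>E\<close> of unordered edges \<open>{i, j}\<close>.
  Edge values are functions of the unordered edge, so that \<open>V\<^sub>i\<^sub>j = V\<^sub>j\<^sub>i\<close> is built in:
  throughout, \<open>V i\<close> is \<open>V\<^sub>i\<close> and \<open>U {i, j}\<close> is \<open>V\<^sub>i\<^sub>j\<close>.
\<close>

definition undirected_graph :: "'a set \<Rightarrow> 'a set set \<Rightarrow> bool" where
  "undirected_graph S E \<longleftrightarrow>
     finite S \<and> (\<forall>e\<in>E. \<exists>i\<in>S. \<exists>j\<in>S. i \<noteq> j \<and> e = {i, j})"

definition adj :: "'a set set \<Rightarrow> 'a rel" where
  "adj F = {(i, j). {i, j} \<in> F}"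

definition connected_graph :: "'a set \<Rightarrow> 'a set set \<Rightarrow> bool" where
  "connected_graph S F \<longleftrightarrow> S \<noteq> {} \<and> (\<forall>i\<in>S. \<forall>j\<in>S. (i, j) \<in> (adj F)\<^sup>*)"

definition components :: "'a set \<Rightarrow> 'a set set \<Rightarrow> 'a set set" where
  "components S F = S // {(i, j). i \<in> S \<and> j \<in> S \<and> (i, j) \<in> (adj F)\<^sup>*}"

text \<open>The edges of the connected component of \<open>F\<close> with vertex set \<open>C\<close>.\<close>

definition edges_in :: "'a set set \<Rightarrow> 'a set \<Rightarrow> 'a set set" where
  "edges_in F C = {e \<in> F. e \<subseteq> C}"

definition undirected_cycle :: "'a set set \<Rightarrow> 'a list \<Rightarrow> bool" where
  "undirected_cycle F xs \<longleftrightarrow>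
     3 \<le> length xs \<and> distinct xs \<and>
     (\<forall>m<length xs. {xs ! m, xs ! (Suc m mod length xs)} \<in> F)"

definition spanning_tree :: "'a set \<Rightarrow> 'a set set \<Rightarrow> 'a set set \<Rightarrow> bool" where
  "spanning_tree S E T \<longleftrightarrow>
     T \<subseteq> E \<and> connected_graph S T \<and> (\<nexists>xs. undirected_cycle T xs)"

definition minimum_spanning_tree ::
  "'a set \<Rightarrow> 'a set set \<Rightarrow> ('a set \<Rightarrow> real) \<Rightarrow> 'a set set \<Rightarrow> bool" where
  "minimum_spanning_tree S E c T \<longleftrightarrow>
     spanning_tree S E T \<and> (\<forall>T'. spanning_tree S E T' \<longrightarrow> sum c T \<le> sum c T')"

definition generic ::
  "'a set \<Rightarrow> 'a set set \<Rightarrow> ('a \<Rightarrow> real) \<Rightarrow> ('a set \<Rightarrow> real) \<Rightarrow> bool" where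
  "generic S E V U \<longleftrightarrow>
     inj_on V S \<and> inj_on U E \<and> V ` S \<inter> U ` E = {} \<and>
     inj_on (\<lambda>(e, k). U e - V k) (E \<times> S)"

text \<open>Directed graphs on \<open>S\<close> are relations; \<open>(i, j) \<in> g\<close> is the arrow \<open>i \<rightarrow> j\<close>.\<close>

definition W_graph :: "'a set \<Rightarrow> 'a set set \<Rightarrow> 'a set \<Rightarrow> 'a rel \<Rightarrow> bool" where
  "W_graph S E W g \<longleftrightarrow>
     W \<subseteq> S \<and> (\<forall>(i, j)\<in>g. {i, j} \<in> E) \<and>
     (\<forall>i\<in>S - W. \<exists>!j. (i, j) \<in> g) \<and> (\<forall>i\<in>W. \<forall>j. (i, j) \<notin> g) \<and>
     acyclic g"

definition W_graphs :: "'a set \<Rightarrow> 'a set set \<Rightarrow> nat \<Rightarrow> 'a rel set" where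
  "W_graphs S E k = {g. \<exists>W. card W = k \<and> W_graph S E W g}"

definition sinks :: "'a set \<Rightarrow> 'a rel \<Rightarrow> 'a set" where
  "sinks S g = S - Domain g"

lemma sinks_W_graph: "W_graph S E W g \<Longrightarrow> sinks S g = W"
  unfolding W_graph_def sinks_def by blast

definition undirected :: "'a rel \<Rightarrow> 'a set set" where
  "undirected g = (\<lambda>(i, j). {i, j}) ` g"

definition W_cost :: "('a \<Rightarrow> real) \<Rightarrow> ('a set \<Rightarrow> real) \<Rightarrow> 'a rel \<Rightarrow> real" where
  "W_cost V U g = (\<Sum>(i, j)\<in>g. U {i, j} - V i)"

definition V_min ::
  "'a set \<Rightarrow> 'a set set \<Rightarrow> ('a \<Rightarrow> real) \<Rightarrow> ('a set \<Rightarrow> real) \<Rightarrow> nat \<Rightarrow> real" where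
  "V_min S E V U k = Min (W_cost V U ` W_graphs S E k)"

definition optimal_W_graph ::
  "'a set \<Rightarrow> 'a set set \<Rightarrow> ('a \<Rightarrow> real) \<Rightarrow> ('a set \<Rightarrow> real) \<Rightarrow> nat \<Rightarrow> 'a rel \<Rightarrow> bool" where
  "optimal_W_graph S E V U k g \<longleftrightarrow>
     g \<in> W_graphs S E k \<and> W_cost V U g = V_min S E V U k"

text \<open>
  In the tree \<open>t\<close> with vertex set \<open>C\<close> and edge set \<open>edges_in F C\<close>, the vertex sets of the
  two subtrees left after removing an edge \<open>e\<close> are
  \<open>components C (edges_in F C - {e})\<close>; \<open>D\<close> is the one without sinks, that is \<open>t''\<close>.
\<close>

definition tree_max ::
  "('a \<Rightarrow> real) \<Rightarrow> ('a set \<Rightarrow> real) \<Rightarrow> 'a set set \<Rightarrow> 'a set \<Rightarrow> 'a set \<Rightarrow> real" where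
  "tree_max V U F W C =
     Max {U e - V i | e D i. e \<in> edges_in F C \<and>
        D \<in> components C (edges_in F C - {e}) \<and> D \<inter> W = {} \<and> i \<in> D}"

definition forest_max ::
  "'a set \<Rightarrow> ('a \<Rightarrow> real) \<Rightarrow> ('a set \<Rightarrow> real) \<Rightarrow> 'a set set \<Rightarrow> 'a set \<Rightarrow> real" where
  "forest_max S V U F W =
     Max (tree_max V U F W ` {C \<in> components S F. edges_in F C \<noteq> {}})"

end

theory Submission
  imports Defs
begin

text \<open>
  Adjoin to \<open>S\<close> a virtual root, joined to every state \<open>i\<close> by an edge of cost \<open>V i\<close>. The forest of a
  W-graph, together with the root edges at its sinks, is a spanning tree of the extended graph,
  and every spanning tree arises in this way by orienting its edges towards the root. The cost of
  the W-graph is the weight of the tree minus the constant \<open>sum V S\<close>. An optimal W-graph with \<open>k\<close>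
  sinks is therefore a cheapest spanning tree among those of root degree \<open>k\<close>.

  The constraint on the degree is removed by a Lagrange multiplier: lower the cost of every root
  edge by \<open>\<nu>\<close>. Unless \<open>\<nu>\<close> is one of the finitely many critical numbers \<open>V i - U e\<close>, all weights are
  distinct, and the spanning tree of least weight is unique: it consists of the edges that are not
  spanned by lighter edges (\<open>min_basis_greedy\<close>). If it has \<open>k\<close> root edges, it is the tree of every
  optimal W-graph with \<open>k\<close> sinks (\<open>optimal_greedy\<close>). When \<open>\<nu>\<close> grows, root edges become lighter
  relative to the other edges, so the greedy tree only gains root edges and only loses edges of the
  graph; this gives the two inclusions.

  It remains to see that every \<open>k\<close> occurs for some \<open>\<nu>\<close>. A state \<open>i\<close> that does not minimise \<open>V\<close> has
  a bottleneck edge \<open>d i\<close>: the edges of cost below \<open>\<theta>\<close> connect \<open>i\<close> to a state of smaller value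
  exactly when \<open>U (d i) < \<theta>\<close> (\<open>merge_edge\<close>). Such a state is a sink of the greedy tree exactly when
  \<open>\<nu>\<close> exceeds the threshold \<open>V i - U (d i)\<close>. Genericness makes these thresholds distinct, so the sinks appear one at a time
  (\<open>level_with_sinks\<close>).

  By nesting, the tree for \<open>k + 1\<close> sinks arises from the one for \<open>k\<close> sinks by exchanging an edge
  \<open>e\<close> for a new root edge at \<open>i\<close>. The pairs over which \<open>forest_max\<close> maximises are precisely those
  for which this exchange yields a tree, so optimality selects the maximal saving \<open>U e - V i\<close>
  (\<open>V_min_Suc\<close>). For a single sink, the forest is a spanning tree of the graph and the sink can
  be chosen independently of it (\<open>V_min_one\<close>).
\<close>

section \<open>Reachability in undirected graphs\<close>

lemma reach_sym: "(u, v) \<in> (adj F)\<^sup>* \<Longrightarrow> (v, u) \<in> (adj F)\<^sup>*"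
proof -
  have "sym (adj F)" by (auto simp: sym_def adj_def insert_commute)
  then show "(u, v) \<in> (adj F)\<^sup>* \<Longrightarrow> (v, u) \<in> (adj F)\<^sup>*" by (meson sym_rtrancl symE)
qed

lemma reach_trans: "(u, v) \<in> (adj F)\<^sup>* \<Longrightarrow> (v, w) \<in> (adj F)\<^sup>* \<Longrightarrow> (u, w) \<in> (adj F)\<^sup>*"
  by (rule rtrancl_trans)

lemma adj_mono: "F \<subseteq> G \<Longrightarrow> adj F \<subseteq> adj G"
  by (auto simp: adj_def)

lemma reach_mono: "(u, v) \<in> (adj F)\<^sup>* \<Longrightarrow> F \<subseteq> G \<Longrightarrow> (u, v) \<in> (adj G)\<^sup>*"
  using rtrancl_mono[OF adj_mono] by blast

lemma reach_edge: "{u, v} \<in> F \<Longrightarrow> (u, v) \<in> (adj F)\<^sup>*"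
  by (auto simp: adj_def)

text \<open>The edge \<open>{c, d}\<close> is needed at most once, in one of its two directions.\<close>

lemma reach_insert:
  assumes "(x, y) \<in> (adj (insert {c, d} F))\<^sup>*"
  shows "(x, y) \<in> (adj F)\<^sup>* \<or> (x, c) \<in> (adj F)\<^sup>* \<and> (d, y) \<in> (adj F)\<^sup>*
    \<or> (x, d) \<in> (adj F)\<^sup>* \<and> (c, y) \<in> (adj F)\<^sup>*"
  using assms
proof (induction rule: rtrancl_induct)
  case (step y z)
  have "(y, z) \<in> (adj F)\<^sup>* \<or> y = c \<and> z = d \<or> y = d \<and> z = c"
    using step.hyps(2) by (auto simp: adj_def doubleton_eq_iff)
  with step.IH show ?case
    by (metis reach_trans rtrancl.rtrancl_refl)
qed simp

lemma reach_subst: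
  assumes "(x, y) \<in> (adj F)\<^sup>*" "\<And>u v. {u, v} \<in> F \<Longrightarrow> (u, v) \<in> (adj G)\<^sup>*"
  shows "(x, y) \<in> (adj G)\<^sup>*"
  using assms(1)
proof (induction rule: rtrancl_induct)
  case (step y z)
  then show ?case using assms(2) reach_trans by (metis adj_def case_prodD mem_Collect_eq)
qed simp

text \<open>
  Every vertex points to a neighbour that is closer to \<open>r\<close>. Distances decrease along arrows, so
  there are no cycles and no edge is used in both directions.
\<close>

lemma parent_arrows:
  assumes "\<forall>v\<in>N. (v, r) \<in> (adj F)\<^sup>*"
  obtains p where "\<And>v. v \<in> N - {r} \<Longrightarrow> {v, p v} \<in> F"
    and "inj_on (\<lambda>v. {v, p v}) (N - {r})"
    and "acyclic {(v, p v) |v. v \<in> N - {r}}"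
proof -
  define dist where "dist v = (LEAST n. (v, r) \<in> (adj F) ^^ n)" for v
  have ex: "\<exists>u. {v, u} \<in> F \<and> dist u < dist v" if v: "v \<in> N - {r}" for v
  proof -
    have "\<exists>n. (v, r) \<in> (adj F) ^^ n" using assms v rtrancl_power by (metis DiffD1)
    then have d: "(v, r) \<in> (adj F) ^^ dist v" unfolding dist_def by (rule LeastI_ex)
    with v obtain n where n: "dist v = Suc n" by (cases "dist v") auto
    with d obtain u where "(v, u) \<in> adj F" "(u, r) \<in> (adj F) ^^ n" by (metis relpow_Suc_D2)
    moreover then have "dist u \<le> n" unfolding dist_def by (auto intro: Least_le)
    ultimately show ?thesis using n by (auto simp: adj_def)
  qed
  define p where "p v = (SOME u. {v, u} \<in> F \<and> dist u < dist v)" for v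
  have p: "{v, p v} \<in> F" "dist (p v) < dist v" if "v \<in> N - {r}" for v
    using someI_ex[OF ex[OF that]] unfolding p_def by auto
  show ?thesis
  proof (rule that[of p])
    show "inj_on (\<lambda>v. {v, p v}) (N - {r})"
    proof (rule inj_onI)
      fix u v assume "u \<in> N - {r}" "v \<in> N - {r}" "{u, p u} = {v, p v}"
      then show "u = v" using p(2)[of u] p(2)[of v] by (auto simp: doubleton_eq_iff)
    qed
    have sub: "{(v, p v) |v. v \<in> N - {r}} \<subseteq> (measure dist)\<inverse>"
      using p(2) by auto
    have "acyclic ((measure dist)\<inverse>)" by (simp add: wf_acyclic)
    then show "acyclic {(v, p v) |v. v \<in> N - {r}}"
      using sub by (rule acyclic_subset)
  qed (use p in auto)
qed

lemma card_edges_ge: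
  assumes "finite F" "\<forall>v\<in>N. (v, r) \<in> (adj F)\<^sup>*"
  shows "card (N - {r}) \<le> card F"
proof -
  obtain p where "\<And>v. v \<in> N - {r} \<Longrightarrow> {v, p v} \<in> F"
    and "inj_on (\<lambda>v. {v, p v}) (N - {r})"
    using parent_arrows[OF assms(2)] by metis
  then show ?thesis using assms(1)
    by (intro card_inj_on_le[of "\<lambda>v. {v, p v}"]) auto
qed

section \<open>Cycles\<close>

text \<open>The edge closing the cycle is bypassed by the rest of the cycle.\<close>

lemma cycle_edge_redundant:
  assumes "undirected_cycle F xs"
  obtains a b where "{a, b} \<in> F" "(a, b) \<in> (adj (F - {{a, b}}))\<^sup>*"
proof -
  have len: "3 \<le> length xs"
    using assms unfolding undirected_cycle_def by (rule conjunct1)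
  have dis: "distinct xs"
    using assms unfolding undirected_cycle_def by (elim conjE)
  have cyc: "\<forall>m<length xs. {xs ! m, xs ! (Suc m mod length xs)} \<in> F"
    using assms unfolding undirected_cycle_def by (elim conjE)
  define l where "l = length xs - 1"
  let ?e = "{xs ! 0, xs ! l}"
  have "(xs ! 0, xs ! m) \<in> (adj (F - {?e}))\<^sup>*" if "m \<le> l" for m
    using that
  proof (induction m)
    case (Suc m)
    have e: "{xs ! m, xs ! Suc m} \<in> F" using cyc[rule_format, of m] Suc.prems len by (simp add: l_def)
    have lt: "0 < length xs" "m < length xs" "Suc m < length xs" "l < length xs"
      using Suc.prems len by (auto simp: l_def)
    have "{xs ! m, xs ! Suc m} \<noteq> ?e"
    proof
      assume "{xs ! m, xs ! Suc m} = ?e"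
      then consider "xs ! m = xs ! 0" "xs ! Suc m = xs ! l" | "xs ! m = xs ! l"
        by (auto simp: doubleton_eq_iff)
      then show False
      proof cases
        case 1
        \<comment> \<open>Then \<open>l = 1\<close>, which the length of the cycle excludes.\<close>
        then have "m = 0" "Suc m = l"
          using lt nth_eq_iff_index_eq[OF dis, of m 0]
            nth_eq_iff_index_eq[OF dis, of "Suc m" l] by simp_all
        then show False using len by (simp add: l_def)
      next
        case 2
        then have "m = l"
          using lt nth_eq_iff_index_eq[OF dis, of m l] by simp
        then show False using Suc.prems by simp
      qed
    qed
    with e have "(xs ! m, xs ! Suc m) \<in> (adj (F - {?e}))\<^sup>*" by (intro reach_edge) auto
    moreover have "(xs ! 0, xs ! m) \<in> (adj (F - {?e}))\<^sup>*" using Suc by simp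
    ultimately show ?case by (rule reach_trans[rotated])
  qed simp
  moreover have "?e \<in> F"
  proof -
    have "Suc l = length xs" using len by (simp add: l_def)
    then show ?thesis using cyc[rule_format, of l] by (simp add: insert_commute)
  qed
  ultimately show ?thesis using that by blast
qed

text \<open>When a walk returns to a vertex it has visited, the detour is cut off.\<close>

lemma distinct_path:
  assumes "(a, b) \<in> R\<^sup>*"
  shows "\<exists>xs. xs \<noteq> [] \<and> distinct xs \<and> hd xs = a \<and> last xs = b \<and>
    (\<forall>m. Suc m < length xs \<longrightarrow> (xs ! m, xs ! Suc m) \<in> R)"
  using assms
proof (induction rule: rtrancl_induct)
  case base
  show ?case by (rule exI[of _ "[a]"]) simp
next
  case (step y z)
  then obtain xs where xs: "xs \<noteq> []" "distinct xs" "hd xs = a" "last xs = y"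
    "\<And>m. Suc m < length xs \<Longrightarrow> (xs ! m, xs ! Suc m) \<in> R" by blast
  show ?case
  proof (cases "z \<in> set xs")
    case True
    then obtain n where n: "n < length xs" "xs ! n = z" by (auto simp: in_set_conv_nth)
    show ?thesis
    proof (intro exI conjI allI impI)
      show "distinct (take (Suc n) xs)" "take (Suc n) xs \<noteq> []" "hd (take (Suc n) xs) = a"
        using xs by simp_all
      show "last (take (Suc n) xs) = z" using n by (simp add: take_Suc_conv_app_nth)
      show "(take (Suc n) xs ! m, take (Suc n) xs ! Suc m) \<in> R"
        if "Suc m < length (take (Suc n) xs)" for m
        using xs(5)[of m] that by simp
    qed
  next
    case False
    show ?thesis
    proof (intro exI conjI allI impI)
      show "xs @ [z] \<noteq> []" "distinct (xs @ [z])" "hd (xs @ [z]) = a" "last (xs @ [z]) = z"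
        using xs False by simp_all
      show "((xs @ [z]) ! m, (xs @ [z]) ! Suc m) \<in> R" if "Suc m < length (xs @ [z])" for m
      proof (cases "Suc m < length xs")
        case True
        then show ?thesis using xs(5)[of m] by (simp add: nth_append)
      next
        case False
        with that have "length xs = Suc m" by simp
        then have "xs ! m = y" using xs(1,4) by (simp add: last_conv_nth)
        then show ?thesis using \<open>length xs = Suc m\<close> step.hyps by (simp add: nth_append)
      qed
    qed
  qed
qed

text \<open>
  A path around the edge has at least three vertices, since its two ends are not joined by any
  other edge; closing it with the edge gives a cycle.
\<close>

lemma acyclic_edge_bridge:
  assumes "\<nexists>xs. undirected_cycle F xs" "{a, b} \<in> F" "a \<noteq> b"
  shows "(a, b) \<notin> (adj (F - {{a, b}}))\<^sup>*"
proof
  assume "(a, b) \<in> (adj (F - {{a, b}}))\<^sup>*"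
  from distinct_path[OF this] obtain xs where xs: "xs \<noteq> []" "distinct xs" "hd xs = a" "last xs = b"
    "\<And>m. Suc m < length xs \<Longrightarrow> {xs ! m, xs ! Suc m} \<in> F - {{a, b}}"
    by (auto simp: adj_def)
  have ends: "xs ! 0 = a" "xs ! (length xs - 1) = b"
    using xs by (simp_all add: hd_conv_nth last_conv_nth)
  have "length xs \<noteq> 0" using xs by simp
  moreover have "length xs \<noteq> 1" using ends assms(3) by auto
  moreover have "length xs \<noteq> 2" using ends xs(5)[of 0] by auto
  ultimately have "3 \<le> length xs" by linarith
  moreover have "{xs ! m, xs ! (Suc m mod length xs)} \<in> F" if "m < length xs" for m
  proof (cases "Suc m < length xs")
    case True
    then show ?thesis using xs(5) by simp
  next
    case False
    with that have "Suc m = length xs" "m = length xs - 1" by auto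
    then show ?thesis using ends assms(2) by (simp add: insert_commute)
  qed
  ultimately have "undirected_cycle F xs" using xs(2) by (simp add: undirected_cycle_def)
  then show False using assms(1) by blast
qed

section \<open>Minimum weight bases\<close>

text \<open>
  The part of matroid theory that concerns minimum bases, for a matroid given by its closure
  operator. The number \<open>r\<close> is a lower bound for the size of spanning sets; a basis attains it, so
  that exchanging one element yields a basis as soon as the result spans.
\<close>

locale matroid_closure =
  fixes Q :: "'e set" and cl :: "'e set \<Rightarrow> 'e set" and r :: nat
  assumes finite_ground: "finite Q"
    and extensive: "X \<subseteq> Q \<Longrightarrow> X \<subseteq> cl X"
    and hull: "X \<subseteq> cl Y \<Longrightarrow> cl X \<subseteq> cl Y"
    and exchange: "\<lbrakk>x \<in> Q; y \<in> Q; x \<in> cl (insert y X); x \<notin> cl X\<rbrakk> \<Longrightarrow> y \<in> cl (insert x X)"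
    and rank: "\<lbrakk>X \<subseteq> Q; Q \<subseteq> cl X\<rbrakk> \<Longrightarrow> r \<le> card X"
begin

definition basis :: "'e set \<Rightarrow> bool" where
  "basis B \<longleftrightarrow> B \<subseteq> Q \<and> Q \<subseteq> cl B \<and> card B = r"

definition greedy :: "('e \<Rightarrow> real) \<Rightarrow> 'e set" where
  "greedy w = {x \<in> Q. x \<notin> cl {y \<in> Q. w y < w x}}"

lemma cl_mono: "X \<subseteq> Y \<Longrightarrow> Y \<subseteq> Q \<Longrightarrow> cl X \<subseteq> cl Y"
  using extensive[of Y] by (intro hull[of X Y]) simp

lemma basis_finite: "basis B \<Longrightarrow> finite B"
  using finite_ground finite_subset by (auto simp: basis_def)

lemma basis_remove:
  assumes "basis B" "y \<in> B"
  shows "y \<notin> cl (B - {y})"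
proof
  assume "y \<in> cl (B - {y})"
  moreover have "B - {y} \<subseteq> cl (B - {y})" using assms by (intro extensive) (auto simp: basis_def)
  ultimately have "B \<subseteq> cl (B - {y})" by blast
  then have "cl B \<subseteq> cl (B - {y})" by (rule hull)
  then have "Q \<subseteq> cl (B - {y})" using assms by (auto simp: basis_def)
  then have "r \<le> card (B - {y})" using assms by (intro rank) (auto simp: basis_def)
  then show False using assms basis_finite[OF assms(1)]
    by (metis basis_def card_Diff1_less not_le)
qed

text \<open>
  A minimal subset \<open>C\<close> of \<open>B\<close> that contains \<open>A\<close> and spans \<open>x\<close> has an element \<open>y\<close> outside \<open>A\<close>, and
  without \<open>y\<close> it does not span \<open>x\<close>. The exchange property then recovers \<open>y\<close> from \<open>x\<close>.
\<close>

lemma basis_exchange: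
  assumes B: "basis B" and x: "x \<in> Q - B" and A: "A \<subseteq> B" "x \<notin> cl A"
  obtains y where "y \<in> B - A" "basis (insert x (B - {y}))"
proof -
  have sub: "B \<subseteq> Q" and sp: "Q \<subseteq> cl B" using B by (auto simp: basis_def)
  define P where "P C \<longleftrightarrow> A \<subseteq> C \<and> C \<subseteq> B \<and> x \<in> cl C" for C
  have "P B" using x sp A by (auto simp: P_def)
  then have "\<exists>C. P C \<and> (\<forall>C'. P C' \<longrightarrow> card C \<le> card C')" by (rule ex_has_least_nat)
  then obtain C where "P C" and least: "\<forall>C'. P C' \<longrightarrow> card C \<le> card C'" by blast
  then have C: "A \<subseteq> C" "C \<subseteq> B" "x \<in> cl C" by (auto simp: P_def)
  have "C \<noteq> A" using A C by blast
  then obtain y where y: "y \<in> C - A" using C by blast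
  have "finite C" using C basis_finite[OF B] finite_subset by blast
  then have "card (C - {y}) < card C" by (rule card_Diff1_less) (use y in auto)
  moreover have "A \<subseteq> C - {y}" "C - {y} \<subseteq> B" using y C by auto
  ultimately have "x \<notin> cl (C - {y})" using least[rule_format, of "C - {y}"] by (auto simp: P_def)
  moreover have "insert y (C - {y}) = C" using y by blast
  ultimately have "y \<in> cl (insert x (C - {y}))"
    using exchange[of x y "C - {y}"] x y C sub by auto
  also have "\<dots> \<subseteq> cl (insert x (B - {y}))" using C x sub by (intro cl_mono) auto
  finally have "y \<in> cl (insert x (B - {y}))" .
  moreover have "insert x (B - {y}) \<subseteq> cl (insert x (B - {y}))"
    using x sub by (intro extensive) auto
  ultimately have "B \<subseteq> cl (insert x (B - {y}))" by blast
  then have "cl B \<subseteq> cl (insert x (B - {y}))" by (rule hull)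
  then have "Q \<subseteq> cl (insert x (B - {y}))" using sp by blast
  moreover have "card (insert x (B - {y})) = r"
  proof -
    have "y \<in> B" "finite B" "card B = r" using y C basis_finite[OF B] B by (auto simp: basis_def)
    moreover have "0 < card B" using calculation by (auto simp: card_gt_0_iff)
    ultimately show ?thesis using x by (simp add: card_Diff_singleton)
  qed
  moreover have "insert x (B - {y}) \<subseteq> Q" using x sub by blast
  ultimately have "basis (insert x (B - {y}))" unfolding basis_def by (intro conjI)
  moreover have "y \<in> B - A" using y C by blast
  ultimately show ?thesis by (rule that[rotated])
qed

lemma basis_swap:
  assumes B: "basis B" and "x \<in> Q" "y \<in> B" "x \<notin> cl (B - {y})" "x \<noteq> y"
  shows "basis (insert x (B - {y}))"
proof -
  have "B - {y} \<subseteq> cl (B - {y})" using B by (intro extensive) (auto simp: basis_def)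
  then have "x \<notin> B" using assms(4,5) by blast
  then obtain y' where "y' \<in> B - (B - {y})" "basis (insert x (B - {y'}))"
    using basis_exchange[of B x "B - {y}"] assms by blast
  then show ?thesis by auto
qed

text \<open>
  In an optimal basis \<open>B\<close> every \<open>x\<close> is spanned by elements of \<open>B\<close> that are at most as heavy as \<open>x\<close>;
  otherwise \<open>x\<close> could replace a heavier element. An element outside \<open>B\<close> is thus spanned by lighter
  ones. An element \<open>x\<close> of \<open>B\<close> is not: all elements lighter than \<open>x\<close> are spanned by \<open>B - {x}\<close>, which
  does not span \<open>x\<close>.
\<close>

lemma min_basis_greedy:
  assumes inj: "inj_on w Q" and B: "basis B"
    and opt: "\<And>B'. basis B' \<Longrightarrow> sum w B \<le> sum w B'"
  shows "B = greedy w"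
proof -
  have sub: "B \<subseteq> Q" using B by (auto simp: basis_def)
  have light: "x \<in> cl {y \<in> B. w y \<le> w x}" if x: "x \<in> Q" for x
  proof (cases "x \<in> B")
    case True
    then show ?thesis using extensive[of "{y \<in> B. w y \<le> w x}"] sub by blast
  next
    case False
    show ?thesis
    proof (rule ccontr)
      assume "x \<notin> cl {y \<in> B. w y \<le> w x}"
      with False x obtain y where y: "y \<in> B - {y \<in> B. w y \<le> w x}" "basis (insert x (B - {y}))"
        using basis_exchange[OF B, of x "{y \<in> B. w y \<le> w x}"] by blast
      have "sum w (insert x (B - {y})) = w x + (sum w B - w y)"
        using False y basis_finite[OF B] by (simp add: sum_diff1)
      then show False using opt[OF y(2)] y(1) by simp
    qed
  qed
  show ?thesis
  proof
    show "greedy w \<subseteq> B"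
    proof
      fix x assume x: "x \<in> greedy w"
      show "x \<in> B"
      proof (rule ccontr)
        assume "x \<notin> B"
        then have "{y \<in> B. w y \<le> w x} \<subseteq> {y \<in> Q. w y < w x}"
          using sub x inj_onD[OF inj, of _ x] by (force simp: greedy_def less_le)
        then have "cl {y \<in> B. w y \<le> w x} \<subseteq> cl {y \<in> Q. w y < w x}" by (intro cl_mono) auto
        then show False using light[of x] x by (auto simp: greedy_def)
      qed
    qed
    show "B \<subseteq> greedy w"
    proof
      fix x assume x: "x \<in> B"
      have "{y \<in> Q. w y < w x} \<subseteq> cl (B - {x})"
      proof
        fix y assume y: "y \<in> {y \<in> Q. w y < w x}"
        then have "cl {z \<in> B. w z \<le> w y} \<subseteq> cl (B - {x})" using sub by (intro cl_mono) auto
        then show "y \<in> cl (B - {x})" using light[of y] y by auto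
      qed
      then have "cl {y \<in> Q. w y < w x} \<subseteq> cl (B - {x})" by (rule hull)
      then show "x \<in> greedy w" using basis_remove[OF B x] x sub by (auto simp: greedy_def)
    qed
  qed
qed

lemma min_basis_exists:
  assumes "basis B"
  obtains B' where "basis B'" "\<And>B''. basis B'' \<Longrightarrow> sum w B' \<le> (sum w B'' :: real)"
proof -
  have "Collect basis \<subseteq> Pow Q" by (auto simp: basis_def)
  then have "finite (Collect basis)" by (rule finite_subset) (simp add: finite_ground)
  moreover have "Collect basis \<noteq> {}" using assms by auto
  ultimately show ?thesis using that ex_is_arg_min_if_finite[of "Collect basis" "sum w"]
    by (auto simp: is_arg_min_linorder)
qed

end

section \<open>Counting below a level\<close>

text \<open>
  Passing from \<open>x\<close> to a point just beyond the next element \<open>d\<close> of \<open>D\<close>, and before the element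
  of \<open>C\<close> that follows \<open>d\<close>, raises the count by one.
\<close>

lemma level_exists:
  fixes C D :: "real set"
  assumes "finite C" "D \<subseteq> C" "k \<le> card D"
  shows "\<exists>x. x \<notin> C \<and> card {d \<in> D. d < x} = k"
  using assms(3)
proof (induction k)
  case 0
  define x where "x = Min (insert 0 C) - 1"
  have "x < c" if "c \<in> C" for c
  proof -
    have "Min (insert 0 C) \<le> c" using that assms(1) by (intro Min_le) auto
    then show ?thesis by (simp add: x_def)
  qed
  then have "x \<notin> C" "{d \<in> D. d < x} = {}" using assms(2) by fastforce+
  then show ?case by (metis card.empty)
next
  case (Suc k)
  have fin: "finite D" using assms finite_subset by blast
  obtain x where x: "x \<notin> C" "card {d \<in> D. d < x} = k" using Suc by auto
  have "{d \<in> D. x < d} \<noteq> {}"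
  proof
    assume "{d \<in> D. x < d} = {}"
    then have "{d \<in> D. d < x} = D" using x(1) assms(2) by (force simp: not_less_iff_gr_or_eq)
    then show False using x Suc.prems by simp
  qed
  define d where "d = Min {d \<in> D. x < d}"
  have d: "d \<in> D" "x < d" "\<And>d'. d' \<in> D \<Longrightarrow> x < d' \<Longrightarrow> d \<le> d'"
    using Min_in[of "{d \<in> D. x < d}"] \<open>{d \<in> D. x < d} \<noteq> {}\<close> fin by (auto simp: d_def)
  have "\<exists>y>d. \<forall>c\<in>C. d < c \<longrightarrow> y < c"
  proof (cases "{c \<in> C. d < c} = {}")
    case True
    then show ?thesis by (intro exI[of _ "d + 1"]) auto
  next
    case False
    then have "d < Min {c \<in> C. d < c}" using assms(1) by simp
    then obtain y where "d < y" "y < Min {c \<in> C. d < c}" using dense by blast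
    then show ?thesis using assms(1) False by (intro exI[of _ y]) simp
  qed
  then obtain y where y: "d < y" "\<And>c. c \<in> C \<Longrightarrow> d < c \<Longrightarrow> y < c" by blast
  have "y \<notin> C" using y by blast
  moreover have "{d' \<in> D. d' < y} = insert d {d' \<in> D. d' < x}"
  proof (intro equalityI subsetI)
    fix z assume z: "z \<in> {d' \<in> D. d' < y}"
    then have "\<not> d < z" using y assms(2) by fastforce
    moreover have "z \<noteq> x" using z x assms(2) by auto
    ultimately show "z \<in> insert d {d' \<in> D. d' < x}" using z d(3)[of z] by force
  qed (use d y in auto)
  ultimately show ?case using x fin d by (intro exI[of _ y]) simp
qed

section \<open>Graphs with a virtual root\<close>

text \<open>
  On the edge sets of a graph this is the closure operator of the cycle matroid. It is stated with
  quantifiers over the edge so that no ordering of the end points has to be chosen.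
\<close>

definition spanned :: "'v set set \<Rightarrow> 'v set set" where
  "spanned F = {e. \<forall>u\<in>e. \<forall>v\<in>e. (u, v) \<in> (adj F)\<^sup>*}"

lemma doubleton_spanned: "{u, v} \<in> spanned F \<longleftrightarrow> (u, v) \<in> (adj F)\<^sup>*"
  using reach_sym by (auto simp: spanned_def)

text \<open>The virtual root is \<open>None\<close>; the states are embedded by \<open>Some\<close>.\<close>

definition root_edge :: "'a \<Rightarrow> 'a option set" where
  "root_edge i = {None, Some i}"

lemma root_edge_spanned: "root_edge i \<in> spanned X \<longleftrightarrow> (Some i, None) \<in> (adj X)\<^sup>*"
  using doubleton_spanned[of "Some i" None X] by (simp add: root_edge_def insert_commute)

definition rooted :: "'a set \<Rightarrow> 'a set set \<Rightarrow> 'a option set set" where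
  "rooted W F = root_edge ` W \<union> (`) Some ` F"

lemma root_edge_eq_iff [simp]: "root_edge i = root_edge j \<longleftrightarrow> i = j"
  by (simp add: root_edge_def doubleton_eq_iff)

lemma lifted_edge_eq_iff [simp]: "Some ` d = Some ` e \<longleftrightarrow> d = e"
  by (simp add: inj_image_eq_iff)

lemma root_edge_not_lifted [simp]: "root_edge i \<noteq> Some ` e" "Some ` e \<noteq> root_edge i"
  by (auto simp: root_edge_def)

lemma root_edge_in_rooted [simp]: "root_edge i \<in> rooted W F \<longleftrightarrow> i \<in> W"
  by (simp add: rooted_def image_iff)

lemma lifted_edge_in_rooted [simp]: "Some ` e \<in> rooted W F \<longleftrightarrow> e \<in> F"
  by (simp add: rooted_def image_iff)

lemma rooted_subset: "rooted W F \<subseteq> rooted W' F' \<longleftrightarrow> W \<subseteq> W' \<and> F \<subseteq> F'"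
proof
  assume "rooted W F \<subseteq> rooted W' F'"
  then have "root_edge i \<in> rooted W F \<Longrightarrow> root_edge i \<in> rooted W' F'"
    "Some ` e \<in> rooted W F \<Longrightarrow> Some ` e \<in> rooted W' F'" for i e by blast+
  then show "W \<subseteq> W' \<and> F \<subseteq> F'" by auto
qed (auto simp: rooted_def)

lemma rooted_eq_iff: "rooted W F = rooted W' F' \<longleftrightarrow> W = W' \<and> F = F'"
  using rooted_subset[of W F W' F'] rooted_subset[of W' F' W F] by blast

lemma rooted_remove_edge: "rooted W F - {Some ` e} = rooted W (F - {e})"
  by (auto simp: rooted_def)

lemma rooted_insert_root: "insert (root_edge i) (rooted W F) = rooted (insert i W) F"
  by (auto simp: rooted_def)

lemma sum_rooted:
  assumes "finite W" "finite F"
  shows "sum f (rooted W F) = (\<Sum>i\<in>W. f (root_edge i)) + (\<Sum>e\<in>F. f (Some ` e))"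
proof -
  have "inj_on root_edge W" by (simp add: inj_on_def)
  moreover have "inj_on ((`) Some) F" by (simp add: inj_on_def)
  moreover have "root_edge ` W \<inter> (`) Some ` F = {}" by auto
  ultimately show ?thesis unfolding rooted_def using assms
    by (simp add: sum.union_disjoint sum.reindex)
qed

lemma card_rooted: "finite W \<Longrightarrow> finite F \<Longrightarrow> card (rooted W F) = card W + card F"
  using sum_rooted[of W F "\<lambda>_. 1 :: nat"] by simp

lemma adj_rooted:
  "(Some i, Some j) \<in> adj (rooted W F) \<longleftrightarrow> {i, j} \<in> F"
  "(Some i, None) \<in> adj (rooted W F) \<longleftrightarrow> i \<in> W"
  "(None, Some i) \<in> adj (rooted W F) \<longleftrightarrow> i \<in> W"
  using lifted_edge_in_rooted[of "{i, j}" W F] root_edge_in_rooted[of i W F]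
  by (simp_all add: adj_def root_edge_def insert_commute del: lifted_edge_in_rooted root_edge_in_rooted)

lemma reach_lift: "(i, j) \<in> (adj F)\<^sup>* \<Longrightarrow> (Some i, Some j) \<in> (adj (rooted W F))\<^sup>*"
proof (induction rule: rtrancl_induct)
  case (step j k)
  then have "(Some j, Some k) \<in> adj (rooted W F)" by (simp add: adj_rooted) (simp add: adj_def)
  with step.IH show ?case by (rule rtrancl.rtrancl_into_rtrancl)
qed simp

text \<open>The first passage of a path through the root leaves the graph at a state of \<open>W\<close>.\<close>

lemma reach_root_iff:
  "(Some i, None) \<in> (adj (rooted W F))\<^sup>* \<longleftrightarrow> (\<exists>w\<in>W. (i, w) \<in> (adj F)\<^sup>*)"
proof
  have "u = None \<or> (\<exists>i w. u = Some i \<and> w \<in> W \<and> (i, w) \<in> (adj F)\<^sup>*)"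
    if "(u, None) \<in> (adj (rooted W F))\<^sup>*" for u
    using that
  proof (induction rule: converse_rtrancl_induct)
    case (step u v)
    show ?case
    proof (cases u)
      case (Some i)
      show ?thesis
      proof (cases v)
        case None
        then show ?thesis using step.hyps(1) Some by (auto simp: adj_rooted)
      next
        case (Some j)
        then obtain w where "w \<in> W" "(j, w) \<in> (adj F)\<^sup>*" using step.IH by auto
        moreover have "(i, j) \<in> adj F"
          using step.hyps(1) \<open>u = Some i\<close> Some by (simp add: adj_rooted) (simp add: adj_def)
        ultimately have "w \<in> W \<and> (i, w) \<in> (adj F)\<^sup>*"
          by (blast intro: converse_rtrancl_into_rtrancl)
        then show ?thesis using \<open>u = Some i\<close> by blast
      qed
    qed simp
  qed simp
  then show "(Some i, None) \<in> (adj (rooted W F))\<^sup>* \<Longrightarrow> \<exists>w\<in>W. (i, w) \<in> (adj F)\<^sup>*" by blast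
next
  assume "\<exists>w\<in>W. (i, w) \<in> (adj F)\<^sup>*"
  then obtain w where "w \<in> W" "(i, w) \<in> (adj F)\<^sup>*" by blast
  then have "(Some w, None) \<in> adj (rooted W F)" "(Some i, Some w) \<in> (adj (rooted W F))\<^sup>*"
    by (simp_all add: adj_rooted reach_lift)
  then show "(Some i, None) \<in> (adj (rooted W F))\<^sup>*" by (rule rtrancl.rtrancl_into_rtrancl[rotated])
qed

text \<open>
  The bases of the cycle matroid of the extended graph are its spanning trees, and they have
  \<open>card S\<close> edges because the extended graph has \<open>card S + 1\<close> vertices.
\<close>

locale landscape =
  fixes S :: "'a set" and E :: "'a set set" and V :: "'a \<Rightarrow> real" and U :: "'a set \<Rightarrow> real"
  assumes graph: "undirected_graph S E"
    and conn: "connected_graph S E"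
    and gen: "generic S E V U"
begin

lemma finite_S: "finite S"
  using graph by (simp add: undirected_graph_def)

lemma edgeE:
  assumes "e \<in> E"
  obtains i j where "i \<in> S" "j \<in> S" "i \<noteq> j" "e = {i, j}"
  using assms graph unfolding undirected_graph_def by blast

lemma finite_E: "finite E"
proof -
  have "E \<subseteq> Pow S" by (auto elim: edgeE)
  then show ?thesis using finite_S finite_subset by blast
qed

lemma S_nonempty: "S \<noteq> {}"
  using conn by (simp add: connected_graph_def)

abbreviation Q :: "'a option set set" where
  "Q \<equiv> rooted S E"

lemma ground_edgeE:
  assumes "x \<in> Q"
  obtains u v where "x = {u, v}" "u \<in> insert None (Some ` S)" "v \<in> insert None (Some ` S)"
  using assms by (fastforce simp: rooted_def root_edge_def elim: edgeE)

lemma spanning_iff: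
  "Q \<subseteq> spanned X \<longleftrightarrow> (\<forall>i\<in>S. (Some i, None) \<in> (adj X)\<^sup>*)"
proof
  assume Q: "Q \<subseteq> spanned X"
  show "\<forall>i\<in>S. (Some i, None) \<in> (adj X)\<^sup>*"
  proof
    fix i assume "i \<in> S"
    then have "root_edge i \<in> Q" by simp
    with Q have "root_edge i \<in> spanned X" by blast
    then show "(Some i, None) \<in> (adj X)\<^sup>*" by (auto simp: spanned_def root_edge_def)
  qed
next
  assume *: "\<forall>i\<in>S. (Some i, None) \<in> (adj X)\<^sup>*"
  show "Q \<subseteq> spanned X"
  proof
    fix x assume "x \<in> Q"
    then obtain u v where x: "x = {u, v}" "u \<in> insert None (Some ` S)" "v \<in> insert None (Some ` S)"
      by (rule ground_edgeE)
    with * have "(u, None) \<in> (adj X)\<^sup>*" "(v, None) \<in> (adj X)\<^sup>*" by auto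
    then have "(u, v) \<in> (adj X)\<^sup>*" by (blast intro: reach_sym reach_trans)
    then show "x \<in> spanned X" by (simp add: x doubleton_spanned)
  qed
qed

sublocale M: matroid_closure Q spanned "card S"
proof
  show "finite Q" using finite_S finite_E by (simp add: rooted_def)
next
  fix X assume "X \<subseteq> Q"
  show "X \<subseteq> spanned X"
  proof
    fix x assume x: "x \<in> X"
    with \<open>X \<subseteq> Q\<close> obtain u v where "x = {u, v}" using ground_edgeE by blast
    with x show "x \<in> spanned X" by (simp add: doubleton_spanned reach_edge)
  qed
next
  fix X Y :: "'a option set set"
  assume "X \<subseteq> spanned Y"
  then have "(u, v) \<in> (adj Y)\<^sup>*" if "{u, v} \<in> X" for u v
    using that doubleton_spanned[of u v Y] by (simp add: subset_iff)
  then have "(u, v) \<in> (adj Y)\<^sup>*" if "(u, v) \<in> (adj X)\<^sup>*" for u v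
    using that reach_subst by metis
  then show "spanned X \<subseteq> spanned Y"
    unfolding spanned_def by blast
next
  fix x y X
  assume "x \<in> Q" "y \<in> Q" and xy: "x \<in> spanned (insert y X)" "x \<notin> spanned X"
  then obtain a b c d where x: "x = {a, b}" and y: "y = {c, d}" by (metis ground_edgeE)
  have sub: "(u, v) \<in> (adj X)\<^sup>* \<Longrightarrow> (u, v) \<in> (adj (insert {a, b} X))\<^sup>*" for u v
    by (erule reach_mono) blast
  have ab: "(a, b) \<in> (adj (insert {a, b} X))\<^sup>*" by (intro reach_edge) simp
  have "(a, c) \<in> (adj X)\<^sup>* \<and> (d, b) \<in> (adj X)\<^sup>* \<or> (a, d) \<in> (adj X)\<^sup>* \<and> (c, b) \<in> (adj X)\<^sup>*"
    using reach_insert[of a b c d X] xy by (auto simp: x y doubleton_spanned)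
  then have "(c, d) \<in> (adj (insert {a, b} X))\<^sup>*"
    using sub ab by (meson reach_sym reach_trans)
  then show "y \<in> spanned (insert x X)" by (simp add: x y doubleton_spanned)
next
  fix X assume "X \<subseteq> Q" "Q \<subseteq> spanned X"
  moreover have "finite Q" using finite_S finite_E by (simp add: rooted_def)
  ultimately have "card (Some ` S - {None}) \<le> card X"
    using finite_S spanning_iff by (intro card_edges_ge) (auto intro: finite_subset)
  moreover have "Some ` S - {None} = Some ` S" by auto
  ultimately show "card S \<le> card X" by (simp add: card_image)
qed

lemma basis_rooted_iff:
  assumes "W \<subseteq> S" "F \<subseteq> E"
  shows "M.basis (rooted W F) \<longleftrightarrow>
    (\<forall>i\<in>S. \<exists>w\<in>W. (i, w) \<in> (adj F)\<^sup>*) \<and> card W + card F = card S"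
proof -
  have "finite W" "finite F" using assms finite_S finite_E finite_subset by blast+
  then show ?thesis
    using assms by (simp add: M.basis_def spanning_iff rooted_subset card_rooted reach_root_iff)
qed

lemma ground_subsetE:
  assumes "X \<subseteq> Q"
  obtains W F where "X = rooted W F" "W \<subseteq> S" "F \<subseteq> E"
proof (rule that)
  show "X = rooted {i \<in> S. root_edge i \<in> X} {e \<in> E. Some ` e \<in> X}"
    using assms by (auto simp: rooted_def)
qed auto

section \<open>W-graphs as bases\<close>

lemma W_graph_fst:
  assumes "W_graph S E W g"
  shows "inj_on fst g" "fst ` g = S - W"
proof -
  have gE: "{i, j} \<in> E" if "(i, j) \<in> g" for i j using assms that by (auto simp: W_graph_def)
  have gS: "i \<in> S" if "(i, j) \<in> g" for i j
    using gE[OF that] by (metis edgeE insertI1 insertE singletonD)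
  have gW: "i \<notin> W" if "(i, j) \<in> g" for i j using assms that by (auto simp: W_graph_def)
  have uniq: "\<exists>!j. (i, j) \<in> g" if "i \<in> S - W" for i using assms that by (auto simp: W_graph_def)
  show "inj_on fst g"
  proof (rule inj_onI, clarsimp)
    fix i j k assume "(i, j) \<in> g" "(i, k) \<in> g"
    then show "j = k" using uniq[of i] gS gW by blast
  qed
  show "fst ` g = S - W"
  proof
    show "fst ` g \<subseteq> S - W" using gS gW by auto
    show "S - W \<subseteq> fst ` g" using uniq by (force simp: image_iff)
  qed
qed

lemma W_graph_finite: "W_graph S E W g \<Longrightarrow> finite g"
  using W_graph_fst[of W g] finite_S by (metis finite_Diff finite_imageD)

text \<open>An edge used in both directions would be a directed cycle of length two.\<close>

lemma W_graph_inj_undirected: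
  assumes "W_graph S E W g"
  shows "inj_on (\<lambda>(i, j). {i, j}) g"
proof (rule inj_onI, clarify)
  fix i j k l assume ij: "(i, j) \<in> g" and kl: "(k, l) \<in> g" and eq: "{i, j} = {k, l}"
  have acyc: "acyclic g" using assms by (simp add: W_graph_def)
  have "\<not> (k = j \<and> l = i)"
  proof
    assume "k = j \<and> l = i"
    then have "(i, i) \<in> g\<^sup>+" using ij kl by (meson trancl.trancl_into_trancl r_into_trancl)
    then show False using acyc by (simp add: acyclic_def)
  qed
  then show "i = k \<and> j = l" using eq by (auto simp: doubleton_eq_iff)
qed

lemma W_graph_edges: "W_graph S E W g \<Longrightarrow> undirected g \<subseteq> E"
  by (auto simp: W_graph_def undirected_def)

lemma W_graph_sinks: "W_graph S E W g \<Longrightarrow> W \<subseteq> S"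
  by (auto simp: W_graph_def)

lemma W_graph_card_edges:
  assumes "W_graph S E W g"
  shows "card W + card (undirected g) = card S"
proof -
  have "card (undirected g) = card g"
    unfolding undirected_def using W_graph_inj_undirected[OF assms] by (rule card_image)
  also have "\<dots> = card (S - W)" using W_graph_fst[OF assms] by (metis card_image)
  also have "\<dots> = card S - card W"
    using W_graph_sinks[OF assms] finite_S by (simp add: card_Diff_subset finite_subset)
  finally show ?thesis
    using card_mono[OF finite_S W_graph_sinks[OF assms]] by simp
qed

lemma W_graph_reaches_sink:
  assumes g: "W_graph S E W g" and "i \<in> S"
  shows "\<exists>w\<in>W. (i, w) \<in> (adj (undirected g))\<^sup>*"
proof -
  have "wf (g\<inverse>)"
    using g W_graph_finite[OF g] by (intro finite_acyclic_wf_converse) (auto simp: W_graph_def)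
  then have "i \<in> S \<longrightarrow> ?thesis"
  proof (induction i rule: wf_induct_rule)
    case (less i)
    show ?case
    proof (cases "i \<in> W \<or> i \<notin> S")
      case False
      then obtain j where ij: "(i, j) \<in> g" using g unfolding W_graph_def by blast
      then have "{i, j} \<in> E" using g by (auto simp: W_graph_def)
      then have "j \<in> S" by (rule edgeE) (auto simp: doubleton_eq_iff)
      with less ij obtain w where "w \<in> W" "(j, w) \<in> (adj (undirected g))\<^sup>*" by auto
      moreover have "(i, j) \<in> (adj (undirected g))\<^sup>*"
        by (intro reach_edge) (use ij in \<open>force simp: undirected_def\<close>)
      ultimately show ?thesis by (blast intro: reach_trans)
    qed auto
  qed
  then show ?thesis using \<open>i \<in> S\<close> by blast
qed

lemma W_graph_basis:
  assumes "W_graph S E W g"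
  shows "M.basis (rooted W (undirected g))"
  using W_graph_reaches_sink[OF assms] W_graph_card_edges[OF assms]
  by (simp add: basis_rooted_iff W_graph_sinks[OF assms] W_graph_edges[OF assms])

text \<open>
  Orient the tree towards the root. The parent edges of the states are \<open>card S\<close> distinct edges of
  the tree, hence all of them; so the sinks are the states whose parent is the root, and no edge of
  \<open>F\<close> is left without a direction.
\<close>

lemma basis_W_graph:
  assumes WF: "W \<subseteq> S" "F \<subseteq> E" and B: "M.basis (rooted W F)"
  obtains g where "W_graph S E W g" "undirected g = F"
proof -
  let ?N = "Some ` S"
  have "\<forall>v\<in>?N. (v, None) \<in> (adj (rooted W F))\<^sup>*"
    using B by (auto simp: M.basis_def spanning_iff)
  then obtain p where p: "\<And>v. v \<in> ?N - {None} \<Longrightarrow> {v, p v} \<in> rooted W F"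
    and inj: "inj_on (\<lambda>v. {v, p v}) (?N - {None})"
    and acyc: "acyclic {(v, p v) |v. v \<in> ?N - {None}}" by (rule parent_arrows) blast
  have N: "?N - {None} = ?N" by auto
  have "card ((\<lambda>v. {v, p v}) ` ?N) = card (rooted W F)"
    using inj B by (simp add: N card_image M.basis_def)
  then have all: "(\<lambda>v. {v, p v}) ` ?N = rooted W F"
    using p M.basis_finite[OF B] by (intro card_subset_eq) (auto simp: N)
  define g where "g = {(i, j). i \<in> S \<and> p (Some i) = Some j}"
  have sink: "p (Some i) = None \<longleftrightarrow> i \<in> W" if "i \<in> S" for i
  proof
    assume "p (Some i) = None"
    then have "root_edge i \<in> rooted W F" using p[of "Some i"] that by (simp add: root_edge_def insert_commute)
    then show "i \<in> W" by simp
  next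
    assume "i \<in> W"
    then have "root_edge i \<in> (\<lambda>v. {v, p v}) ` ?N" by (simp add: all)
    then show "p (Some i) = None" by (auto simp: root_edge_def doubleton_eq_iff)
  qed
  have arrow: "{i, j} \<in> F" if "(i, j) \<in> g" for i j
  proof -
    have "Some ` {i, j} \<in> rooted W F" using p[of "Some i"] that by (simp add: g_def)
    then show ?thesis by (simp only: lifted_edge_in_rooted)
  qed
  have "F \<subseteq> undirected g"
  proof
    fix e assume "e \<in> F"
    then have "Some ` e \<in> (\<lambda>v. {v, p v}) ` ?N" by (simp add: all)
    then obtain i where i: "i \<in> S" "Some ` e = {Some i, p (Some i)}" by auto
    then obtain j where j: "p (Some i) = Some j" by (cases "p (Some i)") auto
    then have "Some ` e = Some ` {i, j}" using i by simp
    then have "e = {i, j}" by (simp only: inj_image_eq_iff inj_Some)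
    then show "e \<in> undirected g" using i j by (auto simp: undirected_def g_def)
  qed
  then have und: "undirected g = F" using arrow by (auto simp: undirected_def)
  have "(Some i, Some j) \<in> {(v, p v) |v. v \<in> ?N - {None}}\<^sup>+" if "(i, j) \<in> g\<^sup>+" for i j
    using that
  proof (induction rule: trancl_induct)
    case (base j)
    then show ?case by (intro r_into_trancl) (auto simp: g_def)
  next
    case (step j k)
    then have "(Some j, Some k) \<in> {(v, p v) |v. v \<in> ?N - {None}}" by (auto simp: g_def)
    with step.IH show ?case by (rule trancl.trancl_into_trancl)
  qed
  then have "acyclic g" using acyc unfolding acyclic_def by blast
  moreover have "\<exists>!j. (i, j) \<in> g" if "i \<in> S - W" for i
    using sink[of i] that by (cases "p (Some i)") (auto simp: g_def)
  moreover have "(i, j) \<notin> g" if "i \<in> W" for i j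
    using sink[of i] that WF by (auto simp: g_def)
  ultimately have "W_graph S E W g" using arrow WF unfolding W_graph_def by blast
  then show ?thesis using that und by blast
qed

lemma W_cost_eq:
  assumes "W_graph S E W g"
  shows "W_cost V U g = sum U (undirected g) + sum V W - sum V S"
proof -
  have "W_cost V U g = (\<Sum>x\<in>g. U (case x of (i, j) \<Rightarrow> {i, j})) - (\<Sum>x\<in>g. V (fst x))"
    unfolding W_cost_def by (simp add: sum_subtractf case_prod_beta)
  also have "(\<Sum>x\<in>g. U (case x of (i, j) \<Rightarrow> {i, j})) = sum U (undirected g)"
    unfolding undirected_def using W_graph_inj_undirected[OF assms] by (simp add: sum.reindex o_def)
  also have "(\<Sum>x\<in>g. V (fst x)) = sum V (S - W)"
    using W_graph_fst[OF assms] sum.reindex[of fst g V] by simp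
  also have "\<dots> = sum V S - sum V W"
    using finite_S W_graph_sinks[OF assms] by (rule sum_diff)
  finally show ?thesis by simp
qed

lemma finite_W_graphs: "finite (W_graphs S E k)"
proof -
  have "g \<subseteq> S \<times> S" if "W_graph S E W g" for W g
  proof clarify
    fix i j assume "(i, j) \<in> g"
    then have "{i, j} \<in> E" using that by (auto simp: W_graph_def)
    then show "i \<in> S \<and> j \<in> S" by (rule edgeE) (auto simp: doubleton_eq_iff)
  qed
  then have "W_graphs S E k \<subseteq> Pow (S \<times> S)" unfolding W_graphs_def by blast
  then show ?thesis using finite_S by (meson finite_Pow_iff finite_SigmaI finite_subset)
qed

lemma V_min_le: "W_graph S E W g \<Longrightarrow> V_min S E V U (card W) \<le> W_cost V U g"
  unfolding V_min_def using finite_W_graphs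
  by (intro Min_le) (auto simp: W_graphs_def)

lemma V_min_le_basis:
  assumes "W \<subseteq> S" "F \<subseteq> E" "M.basis (rooted W F)"
  shows "V_min S E V U (card W) \<le> sum U F + sum V W - sum V S"
  using basis_W_graph[OF assms] V_min_le W_cost_eq by metis

lemma optimal_W_graphD:
  assumes "optimal_W_graph S E V U k g"
  shows "W_graph S E (sinks S g) g" "card (sinks S g) = k"
    "V_min S E V U k = sum U (undirected g) + sum V (sinks S g) - sum V S"
proof -
  obtain W where W: "card W = k" "W_graph S E W g"
    using assms by (auto simp: optimal_W_graph_def W_graphs_def)
  then show "W_graph S E (sinks S g) g" "card (sinks S g) = k" using sinks_W_graph by fastforce+
  then show "V_min S E V U k = sum U (undirected g) + sum V (sinks S g) - sum V S"
    using assms W_cost_eq by (simp add: optimal_W_graph_def)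
qed

section \<open>Penalised weights\<close>

text \<open>
  Ground elements are sets of optional states, so the data of an element are recovered through the
  preimage under \<open>Some\<close>: a singleton for a root edge, the original edge otherwise.
\<close>

definition weight :: "real \<Rightarrow> 'a option set \<Rightarrow> real" where
  "weight \<nu> x = (if None \<in> x then V (the_elem (Some -` x)) - \<nu> else U (Some -` x))"

lemma weight_simps [simp]:
  "weight \<nu> (root_edge i) = V i - \<nu>"
  "weight \<nu> (Some ` e) = U e"
proof -
  have "Some -` root_edge i = {i}" by (auto simp: root_edge_def)
  then show "weight \<nu> (root_edge i) = V i - \<nu>" by (simp add: weight_def root_edge_def)
  have "Some -` (Some ` e) = e" by auto
  then show "weight \<nu> (Some ` e) = U e" by (auto simp: weight_def)
qed

lemma sum_weight:
  assumes "W \<subseteq> S" "F \<subseteq> E"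
  shows "sum (weight \<nu>) (rooted W F) = sum U F + sum V W - \<nu> * real (card W)"
proof -
  have "finite W" "finite F" using assms finite_S finite_E finite_subset by blast+
  then show ?thesis by (simp add: sum_rooted sum_subtractf)
qed

text \<open>The multipliers at which a root edge and an edge of the graph have equal weight.\<close>

definition critical :: "real set" where
  "critical = (\<lambda>(i, e). V i - U e) ` (S \<times> E)"

lemma inj_V: "inj_on V S" and inj_U: "inj_on U E"
  using gen by (simp_all add: generic_def)

lemma inj_diff:
  assumes "V i - U e = V j - U f" "i \<in> S" "j \<in> S" "e \<in> E" "f \<in> E"
  shows "i = j"
proof -
  have "inj_on (\<lambda>(e, k). U e - V k) (E \<times> S)" using gen by (simp add: generic_def)
  from inj_onD[OF this, of "(e, i)" "(f, j)"] assms show ?thesis by auto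
qed

lemma inj_weight:
  assumes "\<nu> \<notin> critical"
  shows "inj_on (weight \<nu>) Q"
proof (rule inj_onI)
  have ne: "V i - \<nu> \<noteq> U e" if "i \<in> S" "e \<in> E" for i e
  proof
    assume "V i - \<nu> = U e"
    then have "\<nu> = (\<lambda>(i, e). V i - U e) (i, e)" by simp
    then have "\<nu> \<in> critical" unfolding critical_def by (rule image_eqI) (use that in simp)
    then show False using assms by blast
  qed
  fix x y assume x: "x \<in> Q" and y: "y \<in> Q" and eq: "weight \<nu> x = weight \<nu> y"
  from x consider i where "i \<in> S" "x = root_edge i" | e where "e \<in> E" "x = Some ` e"
    by (auto simp: rooted_def)
  then show "x = y"
  proof cases
    case 1
    from y consider j where "j \<in> S" "y = root_edge j" | e where "e \<in> E" "y = Some ` e"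
      by (auto simp: rooted_def)
    then show ?thesis
    proof cases
      case 1
      then show ?thesis using \<open>i \<in> S\<close> \<open>x = root_edge i\<close> eq inj_V by (simp add: inj_on_def)
    next
      case (2 e)
      then show ?thesis using \<open>i \<in> S\<close> \<open>x = root_edge i\<close> eq ne[of i e] by simp
    qed
  next
    case (2 e)
    from y consider j where "j \<in> S" "y = root_edge j" | e where "e \<in> E" "y = Some ` e"
      by (auto simp: rooted_def)
    then show ?thesis
    proof cases
      case (1 j)
      then show ?thesis using 2 eq ne[of j e] by simp
    next
      case (2 f)
      then show ?thesis using \<open>e \<in> E\<close> \<open>x = Some ` e\<close> eq inj_U by (simp add: inj_on_def)
    qed
  qed
qed

definition greedy_sinks :: "real \<Rightarrow> 'a set" where
  "greedy_sinks \<nu> = {i \<in> S. root_edge i \<in> M.greedy (weight \<nu>)}"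

definition greedy_edges :: "real \<Rightarrow> 'a set set" where
  "greedy_edges \<nu> = {e \<in> E. Some ` e \<in> M.greedy (weight \<nu>)}"

lemma greedy_rooted: "M.greedy (weight \<nu>) = rooted (greedy_sinks \<nu>) (greedy_edges \<nu>)"
proof -
  have "M.greedy (weight \<nu>) \<subseteq> Q" by (auto simp: M.greedy_def)
  then obtain W F where "M.greedy (weight \<nu>) = rooted W F" "W \<subseteq> S" "F \<subseteq> E"
    by (rule ground_subsetE)
  moreover from this have "W = greedy_sinks \<nu>" "F = greedy_edges \<nu>"
    by (auto simp: greedy_sinks_def greedy_edges_def)
  ultimately show ?thesis by simp
qed

lemma lighter_root_edge:
  "{y \<in> Q. weight \<nu> y < weight \<nu> (root_edge i)} = rooted {j \<in> S. V j < V i} {e \<in> E. U e < V i - \<nu>}"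
  by (auto simp: rooted_def)

lemma lighter_lifted_edge:
  "{y \<in> Q. weight \<nu> y < weight \<nu> (Some ` e)} = rooted {j \<in> S. V j - \<nu> < U e} {f \<in> E. U f < U e}"
  by (auto simp: rooted_def)

text \<open>
  All root edges are shifted alike, so the lighter root edges are those at states of smaller value,
  for every multiplier. A state is therefore a greedy sink if the edges below \<open>V i - \<nu>\<close> do not
  connect it to a state of smaller value.
\<close>

lemma greedy_sinks_iff:
  "i \<in> greedy_sinks \<nu> \<longleftrightarrow>
    i \<in> S \<and> \<not> (\<exists>j\<in>S. V j < V i \<and> (i, j) \<in> (adj {e \<in> E. U e < V i - \<nu>})\<^sup>*)"
  unfolding greedy_sinks_def M.greedy_def mem_Collect_eq lighter_root_edge root_edge_spanned
    reach_root_iff root_edge_in_rooted by blast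

lemma greedy_edges_iff:
  "e \<in> greedy_edges \<nu> \<longleftrightarrow>
    e \<in> E \<and> Some ` e \<notin> spanned (rooted {j \<in> S. V j - \<nu> < U e} {f \<in> E. U f < U e})"
  unfolding greedy_edges_def M.greedy_def mem_Collect_eq lighter_lifted_edge lifted_edge_in_rooted
  by blast

lemma greedy_sinks_mono:
  assumes "\<nu> \<le> \<mu>"
  shows "greedy_sinks \<nu> \<subseteq> greedy_sinks \<mu>"
proof
  fix i assume i: "i \<in> greedy_sinks \<nu>"
  have "{e \<in> E. U e < V i - \<mu>} \<subseteq> {e \<in> E. U e < V i - \<nu>}" using assms by auto
  then show "i \<in> greedy_sinks \<mu>" using i unfolding greedy_sinks_iff by (meson reach_mono)
qed

lemma greedy_edges_antimono:
  assumes "\<nu> \<le> \<mu>"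
  shows "greedy_edges \<mu> \<subseteq> greedy_edges \<nu>"
proof
  fix e assume e: "e \<in> greedy_edges \<mu>"
  have "rooted {j \<in> S. V j - \<nu> < U e} {f \<in> E. U f < U e}
    \<subseteq> rooted {j \<in> S. V j - \<mu> < U e} {f \<in> E. U f < U e}"
    using assms by (auto simp: rooted_subset)
  then have "spanned (rooted {j \<in> S. V j - \<nu> < U e} {f \<in> E. U f < U e})
    \<subseteq> spanned (rooted {j \<in> S. V j - \<mu> < U e} {f \<in> E. U f < U e})"
    by (intro M.cl_mono) (auto simp: rooted_subset)
  then show "e \<in> greedy_edges \<nu>" using e unfolding greedy_edges_iff by blast
qed

section \<open>Every number of sinks occurs\<close>

text \<open>
  Add the edges to the empty graph in the order of \<open>U\<close>: the edge sought is the one at which the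
  component of \<open>i\<close> first contains a state of smaller value.
\<close>

lemma merge_edge:
  assumes i: "i \<in> S" and ex: "\<exists>j\<in>S. V j < V i"
  shows "\<exists>e\<in>E. \<forall>\<theta>. (\<exists>j\<in>S. V j < V i \<and> (i, j) \<in> (adj {f \<in> E. U f < \<theta>})\<^sup>*) \<longleftrightarrow> U e < \<theta>"
proof -
  define H where "H F \<longleftrightarrow> (\<exists>j\<in>S. V j < V i \<and> (i, j) \<in> (adj F)\<^sup>*)" for F
  have H_mono: "H F \<Longrightarrow> F \<subseteq> F' \<Longrightarrow> H F'" for F F' unfolding H_def by (meson reach_mono)
  define R where "R = {e \<in> E. H {f \<in> E. U f \<le> U e}}"
  have R_edge: "\<exists>e\<in>R. U e < \<theta>" if "H {f \<in> E. U f < \<theta>}" for \<theta>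
  proof -
    let ?L = "{f \<in> E. U f < \<theta>}"
    have "finite ?L" using finite_E by simp
    moreover have "?L \<noteq> {}"
    proof
      assume empty: "?L = {}"
      have "H {}" using that unfolding empty .
      then show False by (auto simp: H_def adj_def)
    qed
    ultimately obtain e where "is_arg_min (\<lambda>f. - U f) (\<lambda>f. f \<in> ?L) e"
      using ex_is_arg_min_if_finite by blast
    then have e: "e \<in> ?L" "\<forall>f\<in>?L. U f \<le> U e" by (simp_all add: is_arg_min_linorder)
    then have "?L \<subseteq> {f \<in> E. U f \<le> U e}" by blast
    with that have "H {f \<in> E. U f \<le> U e}" by (rule H_mono)
    then show ?thesis using e by (auto simp: R_def)
  qed
  have "\<exists>\<theta>. E \<subseteq> {f \<in> E. U f < \<theta>}"
  proof (rule exI, rule subsetI)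
    fix f assume "f \<in> E"
    then have "U f \<le> Max (U ` E)" using finite_E by simp
    then show "f \<in> {f \<in> E. U f < Max (U ` E) + 1}" using \<open>f \<in> E\<close> by auto
  qed
  moreover have "H E" using ex i conn by (auto simp: H_def connected_graph_def)
  ultimately have "R \<noteq> {}" using R_edge H_mono by blast
  moreover have "finite R" using finite_E by (simp add: R_def)
  ultimately obtain e where "is_arg_min U (\<lambda>f. f \<in> R) e"
    using ex_is_arg_min_if_finite by blast
  then have e: "e \<in> R" "\<forall>f\<in>R. U e \<le> U f" by (simp_all add: is_arg_min_linorder)
  have "H {f \<in> E. U f < \<theta>} \<longleftrightarrow> U e < \<theta>" for \<theta>
  proof
    assume "H {f \<in> E. U f < \<theta>}"
    then show "U e < \<theta>" using R_edge e(2) by (meson le_less_trans)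
  next
    assume "U e < \<theta>"
    then have "{f \<in> E. U f \<le> U e} \<subseteq> {f \<in> E. U f < \<theta>}" by auto
    moreover have "H {f \<in> E. U f \<le> U e}" using e(1) by (simp add: R_def)
    ultimately show "H {f \<in> E. U f < \<theta>}" using H_mono by blast
  qed
  moreover have "e \<in> E" using e(1) by (simp add: R_def)
  ultimately show ?thesis unfolding H_def by blast
qed

text \<open>
  The minimiser \<open>m\<close> of \<open>V\<close> is a greedy sink for every multiplier. Any other state \<open>i\<close> is one as
  soon as the multiplier exceeds \<open>t i\<close>, and the numbers \<open>t i\<close> are distinct. It remains to choose a
  multiplier above exactly \<open>k - 1\<close> of them.
\<close>

lemma level_with_sinks:
  assumes k: "k \<in> {1..card S}"
  shows "\<exists>\<nu>. \<nu> \<notin> critical \<and> card (greedy_sinks \<nu>) = k"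
proof -
  obtain m where "is_arg_min V (\<lambda>i. i \<in> S) m"
    using ex_is_arg_min_if_finite[OF finite_S S_nonempty] by blast
  then have m: "m \<in> S" "\<And>i. i \<in> S \<Longrightarrow> V m \<le> V i" by (auto simp: is_arg_min_linorder)
  define joins where "joins i \<theta> \<longleftrightarrow>
    (\<exists>j\<in>S. V j < V i \<and> (i, j) \<in> (adj {f \<in> E. U f < \<theta>})\<^sup>*)" for i \<theta>
  have "\<forall>i\<in>S - {m}. \<exists>e. e \<in> E \<and> (\<forall>\<theta>. joins i \<theta> \<longleftrightarrow> U e < \<theta>)"
  proof
    fix i assume i: "i \<in> S - {m}"
    then have "V m \<noteq> V i" using inj_V m by (auto simp: inj_on_def)
    then have "V m < V i" using m(2)[of i] i by simp
    then have "\<exists>j\<in>S. V j < V i" using m by blast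
    moreover have "i \<in> S" using i by blast
    ultimately show "\<exists>e. e \<in> E \<and> (\<forall>\<theta>. joins i \<theta> \<longleftrightarrow> U e < \<theta>)"
      using merge_edge[of i] unfolding joins_def by blast
  qed
  from bchoice[OF this] obtain d where d: "\<And>i. i \<in> S - {m} \<Longrightarrow> d i \<in> E"
    "\<And>i \<theta>. i \<in> S - {m} \<Longrightarrow> joins i \<theta> \<longleftrightarrow> U (d i) < \<theta>"
    by blast
  define t where "t i = V i - U (d i)" for i
  have inj_t: "inj_on t (S - {m})"
    using inj_diff d(1) by (auto simp: inj_on_def t_def)
  have t_crit: "t ` (S - {m}) \<subseteq> critical" using d(1) by (force simp: t_def critical_def)
  have card_t: "card (t ` (S - {m})) = card S - 1"
    using m(1) finite_S by (simp add: card_image[OF inj_t])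
  have "finite critical" using finite_S finite_E by (simp add: critical_def)
  moreover have "k - 1 \<le> card (t ` (S - {m}))" using k unfolding card_t by (intro diff_le_mono) simp
  ultimately obtain \<nu> where lam: "\<nu> \<notin> critical" "card {x \<in> t ` (S - {m}). x < \<nu>} = k - 1"
    using level_exists[OF _ t_crit] by blast
  have "greedy_sinks \<nu> = insert m {i \<in> S - {m}. t i < \<nu>}"
  proof -
    have "m \<in> greedy_sinks \<nu>" using m unfolding greedy_sinks_iff by fastforce
    moreover have "i \<in> greedy_sinks \<nu> \<longleftrightarrow> t i < \<nu>" if i: "i \<in> S - {m}" for i
    proof -
      have "t i \<noteq> \<nu>" using t_crit lam(1) i by blast
      then show ?thesis
        using i unfolding greedy_sinks_iff joins_def[symmetric] d(2)[OF i] t_def by auto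
    qed
    moreover have "greedy_sinks \<nu> \<subseteq> S" by (auto simp: greedy_sinks_def)
    ultimately show ?thesis by blast
  qed
  moreover have "card {i \<in> S - {m}. t i < \<nu>} = k - 1"
  proof -
    have "t ` {i \<in> S - {m}. t i < \<nu>} = {x \<in> t ` (S - {m}). x < \<nu>}" by auto
    moreover have "card (t ` {i \<in> S - {m}. t i < \<nu>}) = card {i \<in> S - {m}. t i < \<nu>}"
      using inj_t by (intro card_image) (rule inj_on_subset, auto)
    ultimately show ?thesis using lam(2) by simp
  qed
  moreover have "finite {i \<in> S - {m}. t i < \<nu>}" using finite_S by simp
  ultimately have "card (greedy_sinks \<nu>) = k" using k by simp
  then show ?thesis using lam(1) by blast
qed

section \<open>Nesting of optimal W-graphs\<close>

text \<open>
  Among trees with \<open>k\<close> root edges the multiplier contributes the same amount \<open>- \<nu> * k\<close>. As the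
  greedy tree has \<open>k\<close> root edges, the tree of an optimal W-graph weighs no more, hence is a minimum
  basis too, and that is unique.
\<close>

lemma optimal_greedy:
  assumes lam: "\<nu> \<notin> critical" "card (greedy_sinks \<nu>) = k" and opt: "optimal_W_graph S E V U k g"
  shows "sinks S g = greedy_sinks \<nu> \<and> undirected g = greedy_edges \<nu>"
proof -
  note g = optimal_W_graphD[OF opt]
  note gs = W_graph_sinks[OF g(1)] W_graph_edges[OF g(1)]
  let ?B = "rooted (sinks S g) (undirected g)"
  have B: "M.basis ?B" using W_graph_basis[OF g(1)] .
  obtain B' where B': "M.basis B'" "\<And>B''. M.basis B'' \<Longrightarrow> sum (weight \<nu>) B' \<le> sum (weight \<nu>) B''"
    using M.min_basis_exists[OF B] by blast
  have eq: "B' = rooted (greedy_sinks \<nu>) (greedy_edges \<nu>)"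
    using M.min_basis_greedy[OF inj_weight[OF lam(1)] B'] greedy_rooted by simp
  have sub: "greedy_sinks \<nu> \<subseteq> S" "greedy_edges \<nu> \<subseteq> E" by (auto simp: greedy_sinks_def greedy_edges_def)
  have "V_min S E V U k \<le> sum U (greedy_edges \<nu>) + sum V (greedy_sinks \<nu>) - sum V S"
    using V_min_le_basis[OF sub] B'(1) lam(2) eq by simp
  then have "sum (weight \<nu>) ?B \<le> sum (weight \<nu>) B'"
    unfolding eq sum_weight[OF gs] sum_weight[OF sub] using g lam(2) by simp
  then have "?B = M.greedy (weight \<nu>)"
    using B'(2) by (intro M.min_basis_greedy inj_weight lam B) (meson order_trans)
  then show ?thesis by (simp add: greedy_rooted rooted_eq_iff)
qed

text \<open>
  Both graphs are greedy trees. The multiplier of the one with more sinks is the larger one, since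
  the set of greedy sinks grows with the multiplier.
\<close>

lemma optimal_nested:
  assumes k: "k \<in> {1..<card S}"
    and g: "optimal_W_graph S E V U k g" and h: "optimal_W_graph S E V U (k + 1) h"
  shows "sinks S g \<subset> sinks S h" "undirected h \<subset> undirected g"
proof -
  note gD = optimal_W_graphD[OF g] and hD = optimal_W_graphD[OF h]
  obtain \<nu> where l: "\<nu> \<notin> critical" "card (greedy_sinks \<nu>) = k"
    using level_with_sinks[of k] k by auto
  obtain \<mu> where mu: "\<mu> \<notin> critical" "card (greedy_sinks \<mu>) = k + 1"
    using level_with_sinks[of "k + 1"] k by auto
  have "\<nu> \<le> \<mu>"
  proof (rule ccontr)
    assume "\<not> \<nu> \<le> \<mu>"
    then have "greedy_sinks \<mu> \<subseteq> greedy_sinks \<nu>" by (intro greedy_sinks_mono) simp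
    moreover have "finite (greedy_sinks \<nu>)" using finite_S by (simp add: greedy_sinks_def)
    ultimately have "card (greedy_sinks \<mu>) \<le> card (greedy_sinks \<nu>)" by (intro card_mono)
    then show False using l(2) mu(2) by simp
  qed
  then have "sinks S g \<subseteq> sinks S h" "undirected h \<subseteq> undirected g"
    using optimal_greedy[OF l g] optimal_greedy[OF mu h] greedy_sinks_mono greedy_edges_antimono by simp_all
  moreover have "card (sinks S g) \<noteq> card (sinks S h)" using gD hD by simp
  moreover have "card (undirected g) \<noteq> card (undirected h)"
    using W_graph_card_edges[OF gD(1)] W_graph_card_edges[OF hD(1)] gD hD by simp
  ultimately show "sinks S g \<subset> sinks S h" "undirected h \<subset> undirected g" by auto
qed

section \<open>Single exchanges\<close>

lemma mem_components:
  "C \<in> components A F \<longleftrightarrow> (\<exists>i\<in>A. C = {j \<in> A. (i, j) \<in> (adj F)\<^sup>*})"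
proof -
  have "{(i, j). i \<in> A \<and> j \<in> A \<and> (i, j) \<in> (adj F)\<^sup>*} `` {i} = {j \<in> A. (i, j) \<in> (adj F)\<^sup>*}"
    if "i \<in> A" for i
    using that by auto
  then show ?thesis by (auto simp: components_def quotient_def)
qed

text \<open>
  Removing \<open>e\<close> separates \<open>i\<close> from all sinks. These are the pairs for which \<open>e\<close> can be exchanged
  for a new sink at \<open>i\<close>; in the notation of the theorem, \<open>i\<close> lies in \<open>t''\<close>.
\<close>

definition cut_off :: "'a set \<Rightarrow> 'a set set \<Rightarrow> 'a set \<Rightarrow> 'a \<Rightarrow> bool" where
  "cut_off W F e i \<longleftrightarrow> e \<in> F \<and> i \<in> S \<and> \<not> (\<exists>w\<in>W. (i, w) \<in> (adj (F - {e}))\<^sup>*)"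

lemma cut_off_swap:
  assumes WF: "W \<subseteq> S" "F \<subseteq> E" "M.basis (rooted W F)" and ei: "cut_off W F e i"
  shows "M.basis (rooted (insert i W) (F - {e}))"
proof -
  have "root_edge i \<notin> spanned (rooted W F - {Some ` e})"
    using ei unfolding rooted_remove_edge
    by (simp add: root_edge_spanned reach_root_iff cut_off_def)
  then have "M.basis (insert (root_edge i) (rooted W F - {Some ` e}))"
    using ei WF by (intro M.basis_swap) (auto simp: cut_off_def)
  then show ?thesis by (simp only: rooted_remove_edge rooted_insert_root)
qed

text \<open>
  If both ends of \<open>e\<close> still reached a sink, they would be connected through the root, and \<open>e\<close>
  would close a cycle in the extended graph.
\<close>

lemma cut_off_exists:
  assumes WF: "W \<subseteq> S" "F \<subseteq> E" "M.basis (rooted W F)" and e: "e \<in> F"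
  obtains i where "i \<in> e" "cut_off W F e i"
proof -
  obtain a b where ab: "a \<in> S" "b \<in> S" "e = {a, b}" using e WF(2) edgeE by blast
  have "Some ` e \<notin> spanned (rooted W F - {Some ` e})"
    using WF(3) e by (intro M.basis_remove) simp_all
  then have "(Some a, Some b) \<notin> (adj (rooted W (F - {e})))\<^sup>*"
    unfolding rooted_remove_edge by (simp add: ab doubleton_spanned)
  then have "\<not> ((Some a, None) \<in> (adj (rooted W (F - {e})))\<^sup>* \<and>
      (Some b, None) \<in> (adj (rooted W (F - {e})))\<^sup>*)"
    by (meson reach_sym reach_trans)
  then have "\<not> (\<exists>w\<in>W. (a, w) \<in> (adj (F - {e}))\<^sup>*) \<or> \<not> (\<exists>w\<in>W. (b, w) \<in> (adj (F - {e}))\<^sup>*)"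
    by (simp only: reach_root_iff) blast
  then have "cut_off W F e a \<or> cut_off W F e b" using e ab by (simp add: cut_off_def)
  then show ?thesis using that ab by blast
qed

text \<open>
  Paths of the forest that start in \<open>C\<close> stay in \<open>C\<close>, so the splitting of the component \<open>C\<close> can be
  read off from reachability in the whole forest.
\<close>

lemma component_values:
  assumes F: "F \<subseteq> E" and W: "W \<subseteq> S" and C: "C \<in> components S F"
  shows "{U e - V i |e D i. e \<in> edges_in F C \<and> D \<in> components C (edges_in F C - {e}) \<and>
      D \<inter> W = {} \<and> i \<in> D} = {U e - V i |e i. e \<subseteq> C \<and> i \<in> C \<and> cut_off W F e i}"
    (is "?L = ?R")
proof -
  obtain c where C_eq: "C = {j \<in> S. (c, j) \<in> (adj F)\<^sup>*}" using C by (auto simp: mem_components)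
  have inside: "j \<in> C \<and> (i, j) \<in> (adj (edges_in F C - {e}))\<^sup>*"
    if "i \<in> C" "(i, j) \<in> (adj (F - {e}))\<^sup>*" for e i j
    using that(2)
  proof (induction rule: rtrancl_induct)
    case base
    show ?case using that(1) by simp
  next
    case (step j k)
    then have jk: "{j, k} \<in> F - {e}" by (simp add: adj_def)
    then have "k \<in> S" using F by (auto simp: doubleton_eq_iff elim!: edgeE)
    moreover have "(c, k) \<in> (adj F)\<^sup>*"
      using step.IH jk by (auto simp: C_eq intro: reach_trans reach_edge)
    ultimately have "k \<in> C" by (simp add: C_eq)
    then have "{j, k} \<in> edges_in F C - {e}" using jk step.IH by (simp add: edges_in_def)
    then show ?case using \<open>k \<in> C\<close> step.IH by (blast intro: reach_trans reach_edge)
  qed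
  have reach: "(i, j) \<in> (adj (edges_in F C - {e}))\<^sup>* \<longleftrightarrow> (i, j) \<in> (adj (F - {e}))\<^sup>*"
    if "i \<in> C" for e i j
    using inside[OF that] reach_mono[of i j "edges_in F C - {e}" "F - {e}"]
    by (auto simp: edges_in_def)
  show ?thesis
  proof
    show "?L \<subseteq> ?R"
    proof clarify
      fix e D i
      assume e: "e \<in> edges_in F C" and D: "D \<in> components C (edges_in F C - {e})"
        and DW: "D \<inter> W = {}" and i: "i \<in> D"
      obtain d where d: "d \<in> C" "D = {j \<in> C. (d, j) \<in> (adj (edges_in F C - {e}))\<^sup>*}"
        using D by (auto simp: mem_components)
      have di: "i \<in> C" "(d, i) \<in> (adj (F - {e}))\<^sup>*" using i d reach by auto
      have "(i, w) \<notin> (adj (F - {e}))\<^sup>*" if "w \<in> W" for w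
      proof
        assume "(i, w) \<in> (adj (F - {e}))\<^sup>*"
        with di have "(d, w) \<in> (adj (F - {e}))\<^sup>*" by (blast intro: reach_trans)
        with inside d have "w \<in> D" by blast
        then show False using DW that by blast
      qed
      then have "cut_off W F e i" using e di by (auto simp: cut_off_def edges_in_def C_eq)
      then show "\<exists>e' i'. U e - V i = U e' - V i' \<and> e' \<subseteq> C \<and> i' \<in> C \<and> cut_off W F e' i'"
        using e di by (auto simp: edges_in_def)
    qed
    show "?R \<subseteq> ?L"
    proof clarify
      fix e i
      assume e: "e \<subseteq> C" and i: "i \<in> C" and cut: "cut_off W F e i"
      define D where "D = {j \<in> C. (i, j) \<in> (adj (edges_in F C - {e}))\<^sup>*}"
      have "D \<in> components C (edges_in F C - {e})" using i by (auto simp: mem_components D_def)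
      moreover have "D \<inter> W = {}" using cut i reach by (auto simp: D_def cut_off_def)
      moreover have "i \<in> D" using i by (simp add: D_def)
      moreover have "e \<in> edges_in F C" using e cut by (simp add: edges_in_def cut_off_def)
      ultimately show "\<exists>e' D' i'. U e - V i = U e' - V i' \<and> e' \<in> edges_in F C \<and>
          D' \<in> components C (edges_in F C - {e'}) \<and> D' \<inter> W = {} \<and> i' \<in> D'"
        by blast
    qed
  qed
qed

text \<open>
  The nested maximum equals the maximum over all exchangeable pairs. Each inner maximum ranges over
  a nonempty set by \<open>cut_off_exists\<close>, and a pair \<open>(e, i)\<close> contributes to the component of \<open>i\<close>: the
  path from \<open>i\<close> to its sink runs through \<open>e\<close>.
\<close>

lemma forest_max_eq:
  assumes WF: "W \<subseteq> S" "F \<subseteq> E" "M.basis (rooted W F)"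
    and cut: "cut_off W F e i"
    and best: "\<And>f j. cut_off W F f j \<Longrightarrow> U f - V j \<le> U e - V i"
  shows "forest_max S V U F W = U e - V i"
proof -
  define R where "R C = {U f - V j |f j. f \<subseteq> C \<and> j \<in> C \<and> cut_off W F f j}" for C
  have max: "tree_max V U F W C = Max (R C)" if "C \<in> components S F" for C
    unfolding tree_max_def R_def component_values[OF WF(2,1) that] ..
  have fin: "finite (R C)" for C
  proof -
    have "R C \<subseteq> (\<lambda>(f, j). U f - V j) ` (E \<times> S)"
      using WF by (force simp: R_def cut_off_def)
    then show ?thesis using finite_S finite_E finite_subset by blast
  qed
  have le: "tree_max V U F W C \<le> U e - V i" if C: "C \<in> components S F" "edges_in F C \<noteq> {}" for C
  proof -
    obtain f where f: "f \<in> F" "f \<subseteq> C" using C(2) by (auto simp: edges_in_def)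
    obtain j where "j \<in> f" "cut_off W F f j" using cut_off_exists[OF WF f(1)] .
    then have "R C \<noteq> {}" using f by (auto simp: R_def)
    then show ?thesis unfolding max[OF C(1)] using fin best by (auto simp: R_def)
  qed
  define C where "C = {j \<in> S. (i, j) \<in> (adj F)\<^sup>*}"
  have i: "i \<in> S" "e \<in> F" using cut by (auto simp: cut_off_def)
  have C: "C \<in> components S F" using i by (auto simp: C_def mem_components)
  obtain a b where ab: "a \<in> S" "b \<in> S" "e = {a, b}" using i WF(2) edgeE by blast
  obtain w where w: "w \<in> W" "(i, w) \<in> (adj F)\<^sup>*"
    using WF i by (auto simp: basis_rooted_iff)
  have "insert {a, b} (F - {e}) = F" using i ab by auto
  then have "(i, a) \<in> (adj (F - {e}))\<^sup>* \<or> (i, b) \<in> (adj (F - {e}))\<^sup>*"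
    using reach_insert[of i w a b "F - {e}"] w cut by (auto simp: cut_off_def)
  then have "(i, a) \<in> (adj F)\<^sup>* \<or> (i, b) \<in> (adj F)\<^sup>*"
    using reach_mono[of i _ "F - {e}" F] by blast
  moreover have "(a, b) \<in> (adj F)\<^sup>*" "(b, a) \<in> (adj F)\<^sup>*"
    using i ab by (auto intro: reach_edge reach_sym)
  ultimately have "(i, a) \<in> (adj F)\<^sup>*" "(i, b) \<in> (adj F)\<^sup>*" by (blast intro: reach_trans)+
  then have e: "e \<subseteq> C" using ab by (simp add: C_def)
  then have "U e - V i \<in> R C" using cut i by (auto simp: R_def C_def)
  then have "U e - V i \<le> tree_max V U F W C" unfolding max[OF C] using fin by (rule Max_ge[rotated])
  moreover have ne: "edges_in F C \<noteq> {}" using e i by (auto simp: edges_in_def)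
  ultimately have "tree_max V U F W C = U e - V i" using le[OF C ne] by simp
  then have mem: "U e - V i \<in> tree_max V U F W ` {C \<in> components S F. edges_in F C \<noteq> {}}"
    using C ne by force
  have "{C \<in> components S F. edges_in F C \<noteq> {}} \<subseteq> Pow S" by (auto simp: mem_components)
  then have "finite {C \<in> components S F. edges_in F C \<noteq> {}}"
    by (rule finite_subset) (simp add: finite_S)
  then show ?thesis unfolding forest_max_def
    using mem le by (intro Max_eqI) auto
qed

text \<open>
  Nesting shows that the step from \<open>k\<close> to \<open>k + 1\<close> sinks is a single exchange; every other possible
  exchange leads to a W-graph with \<open>k + 1\<close> sinks and thus saves no more.
\<close>

lemma V_min_Suc:
  assumes k: "k \<in> {1..<card S}"
    and g: "optimal_W_graph S E V U k g" and h: "optimal_W_graph S E V U (k + 1) h"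
  shows "V_min S E V U (k + 1) = V_min S E V U k - forest_max S V U (undirected g) (sinks S g)"
proof -
  note gD = optimal_W_graphD[OF g] and hD = optimal_W_graphD[OF h]
  define W F where "W = sinks S g" and "F = undirected g"
  define W' F' where "W' = sinks S h" and "F' = undirected h"
  have sub: "W \<subseteq> S" "F \<subseteq> E" "W' \<subseteq> S" "F' \<subseteq> E"
    unfolding W_def F_def W'_def F'_def
    using gD(1) hD(1) by (simp_all add: W_graph_sinks W_graph_edges)
  have B: "M.basis (rooted W F)" "M.basis (rooted W' F')"
    unfolding W_def F_def W'_def F'_def using gD(1) hD(1) by (simp_all add: W_graph_basis)
  have fin: "finite W" "finite F" "finite W'" "finite F'"
    using sub finite_S finite_E finite_subset by blast+
  have nest: "W \<subseteq> W'" "F' \<subseteq> F"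
    using optimal_nested[OF k g h] by (auto simp: W_def F_def W'_def F'_def)
  have card: "card W = k" "card W' = k + 1" "card F = Suc (card F')"
    using gD hD W_graph_card_edges[OF gD(1)] W_graph_card_edges[OF hD(1)]
    by (simp_all add: W_def F_def W'_def F'_def)
  have "card (W' - W) = 1" "card (F - F') = 1"
    using nest fin card by (simp_all add: card_Diff_subset)
  then obtain i e where "W' - W = {i}" "F - F' = {e}" by (auto simp: card_1_singleton_iff)
  then have i: "W' = insert i W" "i \<notin> W" and e: "F = insert e F'" "e \<notin> F'" using nest by auto
  have cost: "V_min S E V U (k + 1) = V_min S E V U k - (U e - V i)"
    using gD(3) hD(3) i e fin unfolding W_def[symmetric] F_def[symmetric] W'_def[symmetric] F'_def[symmetric]
    by simp
  have Fe: "F - {e} = F'" using e by auto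
  have "cut_off W F e i"
  proof -
    have "root_edge i \<notin> spanned (rooted W' F' - {root_edge i})"
      using i by (intro M.basis_remove B) simp
    moreover have "rooted W' F' - {root_edge i} = rooted W F'" using i by (auto simp: rooted_def)
    ultimately have "(Some i, None) \<notin> (adj (rooted W F'))\<^sup>*" by (simp add: root_edge_spanned)
    then show ?thesis using i e sub by (simp add: cut_off_def reach_root_iff)
  qed
  moreover have "U f - V j \<le> U e - V i" if cut: "cut_off W F f j" for f j
  proof -
    have fj: "f \<in> F" "j \<in> S" "j \<notin> W" using cut by (auto simp: cut_off_def)
    then have "V_min S E V U (card (insert j W)) \<le> sum U (F - {f}) + sum V (insert j W) - sum V S"
      using sub cut_off_swap[OF sub(1,2) B(1) cut] by (intro V_min_le_basis) auto
    then have "V_min S E V U (k + 1) \<le> V_min S E V U k - (U f - V j)"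
      using fj fin card gD(3) by (simp add: sum_diff1 W_def F_def)
    then show ?thesis using cost by simp
  qed
  ultimately have "forest_max S V U F W = U e - V i"
    using forest_max_eq[OF sub(1,2) B(1)] by blast
  then show ?thesis using cost by (simp add: W_def F_def)
qed

section \<open>One sink\<close>

text \<open>
  A minimum spanning tree can be oriented towards the minimiser of \<open>V\<close>. Conversely, the forest of a
  W-graph with one sink is a spanning tree. Edge costs may be negative, so in both directions the
  edge sets have to be matched exactly: the orientation of \<open>T\<close> must use all of \<open>T\<close>, and the forest
  must have no cycle.
\<close>

lemma V_min_one:
  assumes T: "minimum_spanning_tree S E U T" and g: "optimal_W_graph S E V U 1 g"
  shows "V_min S E V U 1 = sum U T + Min (V ` S) - sum V S"
proof (rule antisym)
  note gD = optimal_W_graphD[OF g]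
  have span: "T \<subseteq> E" "connected_graph S T" "\<nexists>xs. undirected_cycle T xs"
    using T by (auto simp: minimum_spanning_tree_def spanning_tree_def)
  have finT: "finite T" using span finite_E finite_subset by blast
  have "Min (V ` S) \<in> V ` S" using finite_S S_nonempty by (intro Min_in) auto
  then obtain m where m: "m \<in> S" "V m = Min (V ` S)" by (metis imageE)
  have to_m: "\<forall>v\<in>S. (v, m) \<in> (adj T)\<^sup>*" using span m by (auto simp: connected_graph_def)
  then obtain p where p: "\<And>v. v \<in> S - {m} \<Longrightarrow> {v, p v} \<in> T"
    and inj: "inj_on (\<lambda>v. {v, p v}) (S - {m})"
    and acyc: "acyclic {(v, p v) |v. v \<in> S - {m}}" by (rule parent_arrows) blast
  define h where "h = {(v, p v) |v. v \<in> S - {m}}"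
  have h: "W_graph S E {m} h"
    unfolding W_graph_def using m p span(1) acyc by (auto simp: h_def)
  have "undirected h = T"
  proof
    show "undirected h \<subseteq> T" using p by (auto simp: undirected_def h_def)
    show "T \<subseteq> undirected h"
    proof (rule ccontr)
      assume "\<not> T \<subseteq> undirected h"
      then obtain e where e: "e \<in> T" "e \<notin> undirected h" by blast
      then obtain a b where ab: "a \<in> S" "b \<in> S" "a \<noteq> b" "e = {a, b}" using span(1) edgeE by blast
      have "(a, m) \<in> (adj (undirected h))\<^sup>*" "(b, m) \<in> (adj (undirected h))\<^sup>*"
        using W_graph_reaches_sink[OF h] ab by auto
      then have "(a, b) \<in> (adj (undirected h))\<^sup>*" by (blast intro: reach_sym reach_trans)
      moreover have "undirected h \<subseteq> T - {{a, b}}"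
        using \<open>undirected h \<subseteq> T\<close> e ab by blast
      ultimately have "(a, b) \<in> (adj (T - {{a, b}}))\<^sup>*" by (rule reach_mono)
      then show False using acyclic_edge_bridge[OF span(3)] e ab by blast
    qed
  qed
  then show "V_min S E V U 1 \<le> sum U T + Min (V ` S) - sum V S"
    using V_min_le[OF h] W_cost_eq[OF h] m by simp
  obtain w where w: "sinks S g = {w}" using gD(2) card_1_singletonE by blast
  define F where "F = undirected g"
  have B: "M.basis (rooted {w} F)" using W_graph_basis[OF gD(1)] by (simp add: w F_def)
  have F: "F \<subseteq> E" "w \<in> S" using W_graph_edges[OF gD(1)] W_graph_sinks[OF gD(1)] by (auto simp: w F_def)
  have to_w: "(i, w) \<in> (adj F)\<^sup>*" if "i \<in> S" for i
    using B F that by (auto simp: basis_rooted_iff)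
  have "connected_graph S F"
    unfolding connected_graph_def using S_nonempty to_w by (blast intro: reach_sym reach_trans)
  moreover have "\<not> undirected_cycle F xs" for xs
  proof
    assume "undirected_cycle F xs"
    then obtain a b where ab: "{a, b} \<in> F" "(a, b) \<in> (adj (F - {{a, b}}))\<^sup>*"
      by (rule cycle_edge_redundant)
    have "Some ` {a, b} \<notin> spanned (rooted {w} F - {Some ` {a, b}})"
      using ab(1) by (intro M.basis_remove B) (simp only: lifted_edge_in_rooted)
    then have "(Some a, Some b) \<notin> (adj (rooted {w} (F - {{a, b}})))\<^sup>*"
      unfolding rooted_remove_edge by (simp add: doubleton_spanned)
    then show False using reach_lift[OF ab(2)] by blast
  qed
  ultimately have "sum U T \<le> sum U F"
    using T F by (auto simp: minimum_spanning_tree_def spanning_tree_def)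
  moreover have "Min (V ` S) \<le> V w" using F finite_S by simp
  ultimately show "sum U T + Min (V ` S) - sum V S \<le> V_min S E V U 1"
    using gD(3) by (simp add: w F_def)
qed

end

theorem theorem3:
  fixes S :: "'a set" and E T :: "'a set set"
    and V :: "'a \<Rightarrow> real" and U :: "'a set \<Rightarrow> real"
    and g :: "nat \<Rightarrow> 'a rel"
  assumes "undirected_graph S E"
    and "connected_graph S E"
    and "generic S E V U"
    and "minimum_spanning_tree S E U T"
    and "\<And>k. k \<in> {1..card S} \<Longrightarrow> optimal_W_graph S E V U k (g k)"
  shows "(\<forall>k\<in>{1..<card S}.
            sinks S (g k) \<subset> sinks S (g (k + 1)) \<and>
            undirected (g k) \<supset> undirected (g (k + 1))) \<and>
         V_min S E V U 1 = (\<Sum>e\<in>T. U e) + Min (V ` S) - (\<Sum>i\<in>S. V i) \<and>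
         (\<forall>k\<in>{1..<card S}.
            V_min S E V U (k + 1) =
              V_min S E V U k - forest_max S V U (undirected (g k)) (sinks S (g k)))"
proof -
  interpret landscape S E V U
    using assms(1-3) by unfold_locales
  have nonempty: "1 \<in> {1..card S}"
    using S_nonempty finite_S by (simp add: Suc_le_eq card_gt_0_iff)
  have opt: "optimal_W_graph S E V U k (g k)" "optimal_W_graph S E V U (k + 1) (g (k + 1))"
    if "k \<in> {1..<card S}" for k
    using assms(5)[of k] assms(5)[of "k + 1"] that by auto
  show ?thesis
    using optimal_nested[OF _ opt] V_min_Suc[OF _ opt] V_min_one[OF assms(4) assms(5)[OF nonempty]]
    by blast
qed

end
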